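(* Let $M=(M_1\times_f M_2)\times_h M_3$ be a sequential warped product equipped with the metric $g=(g_1\oplus f^2g_2)\oplus h^2g_3$, let $(M,g,X,\lambda,\rho)$ be a Ricci-Bourguignon soliton, and let $X$ be a conformal vector field on $(M,g)$. Then: (i) $(M_1,g_1)$ is an Einstein manifold when $\mathrm{Hess} f=\sigma g$ and $\overline{\mathrm{Hess}}\,h=\psi g$ for smooth functions $\sigma,\psi$. (ii) $(M_2,g_2)$ is an Einstein manifold when $\overline{\mathrm{Hess}}\,h=\psi g$ for a smooth function $\psi$. (iii) $(M_3,g_3)$ is an Einstein manifold.
   Context: Let $(M_i,g_i)$, $1\le i\le 3$, be semi-Riemannian manifolds of dimension $n_i$, and let $f:M_1\to\mathbb{R}^+$, $h:M_1\times M_2\to\mathbb{R}^+$ be smooth functions (the warping functions). The sequential warped product $M=(M_1\times_f M_2)\times_h M_3$ is the manifold $M_1\times M_2\times M_3$ with metric $g=(g_1\oplus f^2g_2)\oplus h^2g_3$. Functions and vector fields on the factors are identified with their lifts to $M$. Put $\overline M=M_1\times M_2$ with the metric $g_1\oplus f^2g_2$. $\mathrm{Hess}$ is the Hessian on $(M,g)$ and $\overline{\mathrm{Hess}}$ is the Hessian on $\overline M$. $\mathrm{Hess} f=\sigma g$ is an equality of bilinear forms on $M$; $\overline{\mathrm{Hess}}\,h=\psi g$ is an equality of bilinear forms on vectors tangent to $\overline M$ (where $g$ restricts to $g_1\oplus f^2g_2$). A Ricci-Bourguignon soliton $(M,g,X,\lambda,\rho)$ is a semi-Riemannian manifold $(M,g)$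 with a vector field $X$ and real constants $\lambda,\rho$ such that $\mathrm{Ric}+\frac12\mathcal{L}_Xg=\lambda g+\rho Rg$, where $R$ is the scalar curvature of $g$. A vector field $V$ on $(N,g_N)$ is conformal if $\mathcal{L}_Vg_N=2\alpha g_N$ for some smooth function $\alpha$ on $N$. $(N,g_N)$ is called Einstein if its Ricci tensor is $\mu g_N$ for some smooth function $\mu$ on $N$ (the factor). *)

theory Defs
  imports "HOL-Analysis.Analysis"
begin

section \<open>Smooth maps between Euclidean spaces\<close>

definition dderiv :: "('e::euclidean_space \<Rightarrow> 'b::real_normed_vector) \<Rightarrow> 'e \<Rightarrow> 'e \<Rightarrow> 'b" where
  "dderiv F x u = frechet_derivative F (at x) u"

text \<open>Derivatives are taken in the full space, so this is meant for open \<open>S\<close>, as in all uses below.\<close>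

primrec Ck_on :: "nat \<Rightarrow> 'e::euclidean_space set \<Rightarrow> ('e \<Rightarrow> 'b::real_normed_vector) \<Rightarrow> bool" where
  "Ck_on 0 S F \<longleftrightarrow> continuous_on S F"
| "Ck_on (Suc k) S F \<longleftrightarrow>
     (\<forall>x\<in>S. F differentiable (at x)) \<and> (\<forall>u. Ck_on k S (\<lambda>x. dderiv F x u))"

definition smooth_on :: "'e::euclidean_space set \<Rightarrow> ('e \<Rightarrow> 'b::real_normed_vector) \<Rightarrow> bool" where
  "smooth_on S F \<longleftrightarrow> (\<forall>k. Ck_on k S F)"

section \<open>Smooth manifolds\<close>

text \<open>
  A manifold is a topology together with an indexed atlas: for \<^term>\<open>i\<close> in \<open>midx M\<close> the chart
  \<open>mcoord M i\<close> maps the open set \<open>mdom M i\<close> onto an open subset of the model space \<open>'e\<close>,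
  so the dimension of the manifold is \<open>DIM('e)\<close>. The atlas need not be maximal: all notions below are
  invariant under changes of charts. Indexing the atlas makes the charts of a product
  manifold pairs of charts.
\<close>

record ('i, 'a, 'e) mfd =
  mtop :: "'a topology"
  midx :: "'i set"
  mdom :: "'i \<Rightarrow> 'a set"
  mcoord :: "'i \<Rightarrow> 'a \<Rightarrow> 'e"

abbreviation mcar :: "('i, 'a, 'e) mfd \<Rightarrow> 'a set" where
  "mcar M \<equiv> topspace (mtop M)"

definition mparam :: "('i, 'a, 'e) mfd \<Rightarrow> 'i \<Rightarrow> 'e \<Rightarrow> 'a" where
  "mparam M i = inv_into (mdom M i) (mcoord M i)"

definition mimg :: "('i, 'a, 'e) mfd \<Rightarrow> 'i \<Rightarrow> 'e set" where
  "mimg M i = mcoord M i ` mdom M i"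

definition transition :: "('i, 'a, 'e) mfd \<Rightarrow> 'i \<Rightarrow> 'i \<Rightarrow> 'e \<Rightarrow> 'e" where
  "transition M i j = mcoord M j \<circ> mparam M i"

definition smooth_manifold :: "('i, 'a, 'e::euclidean_space) mfd \<Rightarrow> bool" where
  "smooth_manifold M \<longleftrightarrow>
     mcar M \<noteq> {} \<and> Hausdorff_space (mtop M) \<and> second_countable (mtop M) \<and>
     (\<Union>i\<in>midx M. mdom M i) = mcar M \<and>
     (\<forall>i\<in>midx M. openin (mtop M) (mdom M i) \<and> open (mimg M i) \<and>
        homeomorphic_map (subtopology (mtop M) (mdom M i)) (top_of_set (mimg M i)) (mcoord M i)) \<and>
     (\<forall>i\<in>midx M. \<forall>j\<in>midx M.
        smooth_on (mcoord M i ` (mdom M i \<inter> mdom M j)) (transition M i j))"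

definition smooth_fun :: "('i, 'a, 'e::euclidean_space) mfd \<Rightarrow> ('a \<Rightarrow> real) \<Rightarrow> bool" where
  "smooth_fun M \<phi> \<longleftrightarrow> (\<forall>i\<in>midx M. smooth_on (mimg M i) (\<phi> \<circ> mparam M i))"

definition prod_mfd :: "('i, 'a, 'e) mfd \<Rightarrow> ('j, 'b, 'f) mfd \<Rightarrow> ('i \<times> 'j, 'a \<times> 'b, 'e \<times> 'f) mfd"
    (infixr "\<times>\<^sub>M\<^sub>f" 80) where
  "M \<times>\<^sub>M\<^sub>f N = \<lparr> mtop = prod_topology (mtop M) (mtop N),
                midx = midx M \<times> midx N,
                mdom = (\<lambda>(i, j). mdom M i \<times> mdom N j),
                mcoord = (\<lambda>(i, j) (p, q). (mcoord M i p, mcoord N j q)) \<rparr>"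

section \<open>Tensor fields\<close>

text \<open>
  A tangent vector at \<^term>\<open>p\<close> is represented in each chart \<^term>\<open>i\<close> around \<^term>\<open>p\<close> by an element of the
  model space; under a change of charts representatives are related by the derivative of the
  transition map. Accordingly \<open>X i p\<close> is the value at \<^term>\<open>p\<close> of a vector field, and \<open>g i p u v\<close>
  the value of a (0,2)-tensor field, expressed in the chart \<^term>\<open>i\<close>.
\<close>

type_synonym ('i, 'a, 'e) vfield = "'i \<Rightarrow> 'a \<Rightarrow> 'e"
type_synonym ('i, 'a, 'e) tensor2 = "'i \<Rightarrow> 'a \<Rightarrow> 'e \<Rightarrow> 'e \<Rightarrow> real"

definition change :: "('i, 'a, 'e::euclidean_space) mfd \<Rightarrow> 'i \<Rightarrow> 'i \<Rightarrow> 'a \<Rightarrow> 'e \<Rightarrow> 'e" where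
  "change M i j p u = dderiv (transition M i j) (mcoord M i p) u"

definition smooth_vfield :: "('i, 'a, 'e::euclidean_space) mfd \<Rightarrow> ('i, 'a, 'e) vfield \<Rightarrow> bool" where
  "smooth_vfield M X \<longleftrightarrow>
     (\<forall>i\<in>midx M. smooth_on (mimg M i) (X i \<circ> mparam M i)) \<and>
     (\<forall>i\<in>midx M. \<forall>j\<in>midx M. \<forall>p\<in>mdom M i \<inter> mdom M j. X j p = change M i j p (X i p))"

definition smooth_tensor2 :: "('i, 'a, 'e::euclidean_space) mfd \<Rightarrow> ('i, 'a, 'e) tensor2 \<Rightarrow> bool" where
  "smooth_tensor2 M T \<longleftrightarrow>
     (\<forall>i\<in>midx M. \<forall>p\<in>mdom M i. bilinear (T i p)) \<and>
     (\<forall>i\<in>midx M. \<forall>u v. smooth_on (mimg M i) ((\<lambda>p. T i p u v) \<circ> mparam M i)) \<and>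
     (\<forall>i\<in>midx M. \<forall>j\<in>midx M. \<forall>p\<in>mdom M i \<inter> mdom M j. \<forall>u v.
        T i p u v = T j p (change M i j p u) (change M i j p v))"

definition tensor_eq ::
    "('i, 'a, 'e) mfd \<Rightarrow> ('i, 'a, 'e) tensor2 \<Rightarrow> ('i, 'a, 'e) tensor2 \<Rightarrow> bool" where
  "tensor_eq M S T \<longleftrightarrow> (\<forall>i\<in>midx M. \<forall>p\<in>mdom M i. \<forall>u v. S i p u v = T i p u v)"

text \<open>The tensor field \<open>\<phi> T\<close>.\<close>

definition fscale :: "('a \<Rightarrow> real) \<Rightarrow> ('i, 'a, 'e) tensor2 \<Rightarrow> ('i, 'a, 'e) tensor2" where
  "fscale \<phi> T = (\<lambda>i p u v. \<phi> p * T i p u v)"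

section \<open>Semi-Riemannian metrics\<close>

definition neg_index :: "('e::euclidean_space \<Rightarrow> 'e \<Rightarrow> real) \<Rightarrow> nat" where
  "neg_index b = Max {dim S | S. subspace S \<and> (\<forall>u\<in>S. u \<noteq> 0 \<longrightarrow> b u u < 0)}"

definition semi_riemannian ::
    "('i, 'a, 'e::euclidean_space) mfd \<Rightarrow> ('i, 'a, 'e) tensor2 \<Rightarrow> bool" where
  "semi_riemannian M g \<longleftrightarrow>
     smooth_manifold M \<and> smooth_tensor2 M g \<and>
     (\<forall>i\<in>midx M. \<forall>p\<in>mdom M i.
        (\<forall>u v. g i p u v = g i p v u) \<and> (\<forall>u. (\<forall>v. g i p u v = 0) \<longrightarrow> u = 0)) \<and>
     (\<exists>\<nu>. \<forall>i\<in>midx M. \<forall>p\<in>mdom M i. neg_index (g i p) = \<nu>)"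

section \<open>Curvature on an open subset of the model space\<close>

text \<open>
  Here \<open>G x u v\<close> is a metric in coordinates and the vectors \<open>u\<close>, \<open>v\<close>, \<open>w\<close> are
  regarded as constant (hence commuting) vector fields. \<open>christoffel G x u v\<close> is the value at \<open>x\<close>
  of the Levi-Civita derivative \<open>\<nabla>\<^sub>u v\<close>, given by the Koszul formula.
\<close>

definition christoffel :: "('e::euclidean_space \<Rightarrow> 'e \<Rightarrow> 'e \<Rightarrow> real) \<Rightarrow> 'e \<Rightarrow> 'e \<Rightarrow> 'e \<Rightarrow> 'e" where
  "christoffel G x u v = (THE z. \<forall>w. 2 * G x z w =
     dderiv (\<lambda>y. G y v w) x u + dderiv (\<lambda>y. G y u w) x v - dderiv (\<lambda>y. G y u v) x w)"

text \<open>The curvature \<open>\<nabla>\<^sub>u (\<nabla>\<^sub>v w) - \<nabla>\<^sub>v (\<nabla>\<^sub>u w)\<close>.\<close>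

definition curvature :: "('e::euclidean_space \<Rightarrow> 'e \<Rightarrow> 'e \<Rightarrow> real) \<Rightarrow> 'e \<Rightarrow> 'e \<Rightarrow> 'e \<Rightarrow> 'e \<Rightarrow> 'e" where
  "curvature G x u v w =
     dderiv (\<lambda>y. christoffel G y v w) x u + christoffel G x u (christoffel G x v w)
     - dderiv (\<lambda>y. christoffel G y u w) x v - christoffel G x v (christoffel G x u w)"

definition trace_op :: "('e::euclidean_space \<Rightarrow> 'e) \<Rightarrow> real" where
  "trace_op A = (\<Sum>b\<in>Basis. A b \<bullet> b)"

definition ricci :: "('e::euclidean_space \<Rightarrow> 'e \<Rightarrow> 'e \<Rightarrow> real) \<Rightarrow> 'e \<Rightarrow> 'e \<Rightarrow> 'e \<Rightarrow> real" where
  "ricci G x v w = trace_op (\<lambda>u. curvature G x u v w)"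

text \<open>The metric trace of the Ricci tensor: the trace of the operator \<open>Q\<close> with \<open>G (Q u) v = ricci u v\<close>.\<close>

definition scalar_curv :: "('e::euclidean_space \<Rightarrow> 'e \<Rightarrow> 'e \<Rightarrow> real) \<Rightarrow> 'e \<Rightarrow> real" where
  "scalar_curv G x = trace_op (\<lambda>u. THE z. \<forall>v. G x z v = ricci G x u v)"

text \<open>\<open>u (v F) - (\<nabla>\<^sub>u v) F\<close>\<close>

definition hessian ::
    "('e::euclidean_space \<Rightarrow> 'e \<Rightarrow> 'e \<Rightarrow> real) \<Rightarrow> ('e \<Rightarrow> real) \<Rightarrow> 'e \<Rightarrow> 'e \<Rightarrow> 'e \<Rightarrow> real" where
  "hessian G F x u v = dderiv (\<lambda>y. dderiv F y v) x u - dderiv F x (christoffel G x u v)"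

text \<open>\<open>Y (G u v) - G [Y, u] v - G u [Y, v]\<close>, where \<open>[Y, u] = - dderiv Y x u\<close> for constant \<open>u\<close>.\<close>

definition lie_derivative ::
    "('e::euclidean_space \<Rightarrow> 'e) \<Rightarrow> ('e \<Rightarrow> 'e \<Rightarrow> 'e \<Rightarrow> real) \<Rightarrow> 'e \<Rightarrow> 'e \<Rightarrow> 'e \<Rightarrow> real" where
  "lie_derivative Y G x u v =
     dderiv (\<lambda>y. G y u v) x (Y x) + G x (dderiv Y x u) v + G x u (dderiv Y x v)"

section \<open>Curvature on a semi-Riemannian manifold\<close>

definition local_metric ::
    "('i, 'a, 'e) mfd \<Rightarrow> ('i, 'a, 'e) tensor2 \<Rightarrow> 'i \<Rightarrow> 'e \<Rightarrow> 'e \<Rightarrow> 'e \<Rightarrow> real" where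
  "local_metric M g i = g i \<circ> mparam M i"

definition Ric ::
    "('i, 'a, 'e::euclidean_space) mfd \<Rightarrow> ('i, 'a, 'e) tensor2 \<Rightarrow> ('i, 'a, 'e) tensor2" where
  "Ric M g = (\<lambda>i p. ricci (local_metric M g i) (mcoord M i p))"

text \<open>The scalar curvature at a point does not depend on the chart in which it is computed.\<close>

definition scal ::
    "('i, 'a, 'e::euclidean_space) mfd \<Rightarrow> ('i, 'a, 'e) tensor2 \<Rightarrow> 'a \<Rightarrow> real" where
  "scal M g p = (let i = (SOME i. i \<in> midx M \<and> p \<in> mdom M i)
                 in scalar_curv (local_metric M g i) (mcoord M i p))"

definition Hess ::
    "('i, 'a, 'e::euclidean_space) mfd \<Rightarrow> ('i, 'a, 'e) tensor2 \<Rightarrow> ('a \<Rightarrow> real) \<Rightarrow>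
     ('i, 'a, 'e) tensor2" where
  "Hess M g \<phi> = (\<lambda>i p. hessian (local_metric M g i) (\<phi> \<circ> mparam M i) (mcoord M i p))"

definition Lie ::
    "('i, 'a, 'e::euclidean_space) mfd \<Rightarrow> ('i, 'a, 'e) vfield \<Rightarrow> ('i, 'a, 'e) tensor2 \<Rightarrow>
     ('i, 'a, 'e) tensor2" where
  "Lie M X g = (\<lambda>i p. lie_derivative (X i \<circ> mparam M i) (local_metric M g i) (mcoord M i p))"

definition conformal_vfield ::
    "('i, 'a, 'e::euclidean_space) mfd \<Rightarrow> ('i, 'a, 'e) tensor2 \<Rightarrow> ('i, 'a, 'e) vfield \<Rightarrow> bool" where
  "conformal_vfield M g X \<longleftrightarrow>
     smooth_vfield M X \<and>
     (\<exists>\<alpha>. smooth_fun M \<alpha> \<and> tensor_eq M (Lie M X g) (fscale (\<lambda>p. 2 * \<alpha> p) g))"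

definition einstein_manifold ::
    "('i, 'a, 'e::euclidean_space) mfd \<Rightarrow> ('i, 'a, 'e) tensor2 \<Rightarrow> bool" where
  "einstein_manifold M g \<longleftrightarrow>
     semi_riemannian M g \<and> (\<exists>\<mu>. smooth_fun M \<mu> \<and> tensor_eq M (Ric M g) (fscale \<mu> g))"

definition ricci_bourguignon_soliton ::
    "('i, 'a, 'e::euclidean_space) mfd \<Rightarrow> ('i, 'a, 'e) tensor2 \<Rightarrow> ('i, 'a, 'e) vfield \<Rightarrow>
     real \<Rightarrow> real \<Rightarrow> bool" where
  "ricci_bourguignon_soliton M g X lam \<rho> \<longleftrightarrow>
     semi_riemannian M g \<and> smooth_vfield M X \<and>
     tensor_eq M
       (\<lambda>i p u v. Ric M g i p u v + 1/2 * Lie M X g i p u v)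
       (\<lambda>i p u v. lam * g i p u v + \<rho> * scal M g p * g i p u v)"

section \<open>Warped products\<close>

definition warping_function ::
    "('i, 'a, 'e::euclidean_space) mfd \<Rightarrow> ('a \<Rightarrow> real) \<Rightarrow> bool" where
  "warping_function M \<phi> \<longleftrightarrow> smooth_fun M \<phi> \<and> (\<forall>p\<in>mcar M. \<phi> p > 0)"

text \<open>The metric \<open>g\<^sub>M \<oplus> \<phi>\<^sup>2 g\<^sub>N\<close> on \<open>M \<times> N\<close>.\<close>

definition warped_metric ::
    "('i, 'a, 'e) tensor2 \<Rightarrow> ('a \<Rightarrow> real) \<Rightarrow> ('j, 'b, 'f) tensor2 \<Rightarrow>
     ('i \<times> 'j, 'a \<times> 'b, 'e \<times> 'f) tensor2" where
  "warped_metric gM \<phi> gN = (\<lambda>(i, j) (p, q) (u, u') (v, v').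
     gM i p u v + (\<phi> p)\<^sup>2 * gN j q u' v')"

definition seq_warped_metric ::
    "('i, 'a, 'e) tensor2 \<Rightarrow> ('a \<Rightarrow> real) \<Rightarrow> ('j, 'b, 'f) tensor2 \<Rightarrow> ('a \<times> 'b \<Rightarrow> real) \<Rightarrow>
     ('k, 'c, 'd) tensor2 \<Rightarrow> (('i \<times> 'j) \<times> 'k, ('a \<times> 'b) \<times> 'c, ('e \<times> 'f) \<times> 'd) tensor2" where
  "seq_warped_metric g1 f g2 h g3 = warped_metric (warped_metric g1 f g2) h g3"

end

theory Submission
  imports Defs
begin

text \<open>
  A soliton with conformal field satisfies \<open>Ric = \<mu> g\<close> for a function \<open>\<mu>\<close>. On a warped product with base
  \<open>(B, g\<^sub>B)\<close>, warping function \<open>\<phi>\<close> and fibre \<open>(F, g\<^sub>F)\<close> of dimension \<open>n\<close>, the Ricci tensor is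
  \<open>Ric\<^sub>B - (n / \<phi>) Hess \<phi>\<close> on horizontal vectors and \<open>Ric\<^sub>F - c g\<^sub>F\<close> on vertical vectors, with \<open>c\<close> a
  function on the base. Fixing a point of the base, \<open>Ric = \<mu> g\<close> makes \<open>Ric\<^sub>F\<close> a multiple of \<open>g\<^sub>F\<close>; fixing
  a point of the fibre, it makes \<open>Ric\<^sub>B\<close> a multiple of \<open>g\<^sub>B\<close> whenever \<open>Hess \<phi>\<close> is one. The outer warped
  product gives (iii), and it gives \<open>Ric = \<mu>' g\<close> on \<open>M\<^sub>1 \<times>\<^sub>f M\<^sub>2\<close>, to which the argument applies again;
  \<open>Hess f = \<sigma> g\<close> descends to \<open>M\<^sub>1\<close> because the Hessian of a lift is horizontally the Hessian on the base.
  The factor is smooth since near each point it is a quotient \<open>Ric u v / g u v\<close> with fixed \<open>u, v\<close>.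
\<close>

section \<open>Calculus of smooth maps\<close>

lemma dderiv_works:
  assumes "F differentiable (at x)"
  shows "(F has_derivative dderiv F x) (at x)"
proof -
  have "dderiv F x = frechet_derivative F (at x)"
    by (simp add: dderiv_def fun_eq_iff)
  then show ?thesis
    using assms frechet_derivative_works by metis
qed

lemma dderiv_eqI:
  assumes "(F has_derivative F') (at x)"
  shows "dderiv F x u = F' u"
  using frechet_derivative_at[OF assms] by (simp add: dderiv_def)

lemma linear_dderiv:
  assumes "F differentiable (at x)"
  shows "linear (dderiv F x)"
  using dderiv_works[OF assms] has_derivative_linear by blast

text \<open>Both maps have the same derivatives at \<open>x\<close>, and
  \<open>frechet_derivative\<close> chooses from that set, so the values agree even where no
  derivative exists.\<close>

lemma dderiv_cong:
  assumes "open S" "x \<in> S" "\<And>y. y \<in> S \<Longrightarrow> F y = F' y"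
  shows "dderiv F x u = dderiv F' x u"
proof -
  have "(F has_derivative D) (at x) \<longleftrightarrow> (F' has_derivative D) (at x)" for D
    using assms has_derivative_transform_within_open[of F D x UNIV S F']
      has_derivative_transform_within_open[of F' D x UNIV S F] by auto
  then show ?thesis
    by (simp add: dderiv_def frechet_derivative_def)
qed

lemma differentiable_cong_open:
  assumes "open S" "x \<in> S" "\<And>y. y \<in> S \<Longrightarrow> F y = F' y" "F differentiable (at x)"
  shows "F' differentiable (at x)"
  using assms has_derivative_transform_within_open[of F _ x UNIV S F']
  unfolding differentiable_def by blast

section \<open>Closure properties of C^k maps\<close>

lemma Ck_on_cong:
  assumes "open S" "\<And>y. y \<in> S \<Longrightarrow> F y = F' y" "Ck_on k S F"
  shows "Ck_on k S F'"
  using assms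
proof (induction k arbitrary: F F')
  case 0
  then show ?case by (simp cong: continuous_on_cong)
next
  case (Suc k)
  have "Ck_on k S (\<lambda>x. dderiv F' x u)" for u
  proof (rule Suc.IH[OF Suc.prems(1)])
    show "dderiv F y u = dderiv F' y u" if "y \<in> S" for y
      using dderiv_cong[OF Suc.prems(1) that Suc.prems(2)] .
    show "Ck_on k S (\<lambda>x. dderiv F x u)"
      using Suc.prems by simp
  qed
  moreover have "F' differentiable (at x)" if "x \<in> S" for x
    using differentiable_cong_open[OF Suc.prems(1) that Suc.prems(2)] Suc.prems(3) that by simp
  ultimately show ?case by simp
qed

text \<open>Only the bottom level has content: differentiability gives continuity. Higher levels
  pass the claim on to the directional derivatives.\<close>

lemma Ck_on_SucD: "Ck_on (Suc k) S F \<Longrightarrow> Ck_on k S F"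
proof (induction k arbitrary: F)
  case 0
  then show ?case
    by (auto intro!: continuous_at_imp_continuous_on differentiable_imp_continuous_within)
qed auto

lemma Ck_on_subset: "Ck_on k S F \<Longrightarrow> T \<subseteq> S \<Longrightarrow> Ck_on k T F"
  by (induction k arbitrary: F) (auto intro: continuous_on_subset)

text \<open>Serves the Einstein factor, which is a quotient with nonzero denominator only near a
  chosen point.\<close>

lemma Ck_on_local:
  assumes "\<And>x. x \<in> S \<Longrightarrow> \<exists>W. open W \<and> x \<in> W \<and> Ck_on k W F"
  shows "Ck_on k S F"
  using assms
proof (induction k arbitrary: F)
  case 0
  have "continuous (at x) F" if "x \<in> S" for x
    using 0[OF that] continuous_on_eq_continuous_at by auto
  then show ?case
    by (simp add: continuous_at_imp_continuous_on)
next
  case (Suc k)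
  have "Ck_on k S (\<lambda>x. dderiv F x u)" for u
    using Suc by (fastforce intro: Suc.IH)
  then show ?case using Suc.prems by fastforce
qed

lemma Ck_on_const: "Ck_on k S (\<lambda>x. c)"
proof (induction k arbitrary: c)
  case (Suc k)
  have "dderiv (\<lambda>x::'a. c) x u = 0" for x u
    by (rule dderiv_eqI) (rule has_derivative_const)
  then show ?case using Suc by simp
qed simp

text \<open>The pattern of the closure lemmas that follow: compute the derivative \<open>D\<close>
  on \<open>S\<close>, replace \<open>dderiv\<close> by it through \<open>Ck_on_cong\<close>, and
  apply the induction hypothesis to the result.\<close>

lemma Ck_on_linear:
  fixes F :: "'e::euclidean_space \<Rightarrow> 'b::real_normed_vector"
  assumes "open S" "bounded_linear l" "Ck_on k S F"
  shows "Ck_on k S (\<lambda>x. l (F x))"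
  using assms(3)
proof (induction k arbitrary: F)
  case 0
  then show ?case
    using bounded_linear.continuous_on[OF assms(2)] by simp
next
  case (Suc k)
  have D: "((\<lambda>x. l (F x)) has_derivative (\<lambda>u. l (dderiv F x u))) (at x)" if "x \<in> S" for x
    using Suc.prems that by (intro bounded_linear.has_derivative[OF assms(2)] dderiv_works) auto
  have "Ck_on k S (\<lambda>x. dderiv (\<lambda>x. l (F x)) x u)" for u
    by (rule Ck_on_cong[OF assms(1) _ Suc.IH[of "\<lambda>x. dderiv F x u"]])
      (use dderiv_eqI[OF D] Suc.prems in simp_all)
  then show ?case using D unfolding Ck_on.simps differentiable_def by blast
qed

lemma Ck_on_add:
  assumes "open S" "Ck_on k S F" "Ck_on k S F'"
  shows "Ck_on k S (\<lambda>x. F x + F' x)"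
  using assms(2,3)
proof (induction k arbitrary: F F')
  case 0
  then show ?case by (simp add: continuous_on_add)
next
  case (Suc k)
  have D: "((\<lambda>x. F x + F' x) has_derivative (\<lambda>u. dderiv F x u + dderiv F' x u)) (at x)"
    if "x \<in> S" for x
    using Suc.prems that 
by (intro has_derivative_add dderiv_works) auto
  have "Ck_on k S (\<lambda>x. dderiv (\<lambda>x. F x + F' x) x u)" for u
    by (rule Ck_on_cong[OF assms(1) _ Suc.IH[of "\<lambda>x. dderiv F x u" "\<lambda>x. dderiv F' x u"]])
      (use dderiv_eqI[OF D] Suc.prems in simp_all)
  then show ?case using D unfolding Ck_on.simps differentiable_def by blast
qed

lemma Ck_on_minus:
  assumes "open S" "Ck_on k S F"
  shows "Ck_on k S (\<lambda>x. - F x)"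
  using Ck_on_linear[OF assms(1) bounded_linear_minus[OF bounded_linear_ident] assms(2)] .

lemma Ck_on_diff:
  assumes "open S" "Ck_on k S F" "Ck_on k S F'"
  shows "Ck_on k S (\<lambda>x. F x - F' x)"
  using Ck_on_add[OF assms(1,2) Ck_on_minus[OF assms(1,3)]] by simp

lemma Ck_on_sum:
  assumes "open S" "\<And>i. i \<in> I \<Longrightarrow> Ck_on k S (F i)"
  shows "Ck_on k S (\<lambda>x. \<Sum>i\<in>I. F i x)"
  using assms(2)
  by (induction I rule: infinite_finite_induct) (auto intro: Ck_on_const Ck_on_add assms(1))

lemma Ck_on_scaleR:
  fixes F :: "'e::euclidean_space \<Rightarrow> real" and F' :: "'e \<Rightarrow> 'b::real_normed_vector"
  assumes "open S" "Ck_on k S F" "Ck_on k S F'"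
  shows "Ck_on k S (\<lambda>x. F x *\<^sub>R F' x)"
  using assms(2,3)
proof (induction k arbitrary: F F')
  case 0
  then show ?case by (simp add: continuous_on_scaleR)
next
  case (Suc k)
  have D: "((\<lambda>x. F x *\<^sub>R F' x) has_derivative
      (\<lambda>u. F x *\<^sub>R dderiv F' x u + dderiv F x u *\<^sub>R F' x)) (at x)"
    if "x \<in> S" for x
    using Suc.prems that 
by (intro has_derivative_scaleR dderiv_works) auto
  \<comment> \<open>The product rule leaves the undifferentiated factors in place;
    \<open>Ck_on_SucD\<close> lowers them to order \<open>k\<close>, so that the induction
    hypothesis covers both products.\<close>
  have C: "Ck_on k S (\<lambda>x. F x *\<^sub>R dderiv F' x u + dderiv F x u *\<^sub>R F' x)" for u
    using Suc.prems Ck_on_SucD[OF Suc.prems(1)] Ck_on_SucD[OF Suc.prems(2)]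
    by (intro Ck_on_add assms(1) Suc.IH) auto
  have "Ck_on k S (\<lambda>x. dderiv (\<lambda>x. F x *\<^sub>R F' x) x u)" for u
    by (rule Ck_on_cong[OF assms(1) _ C[of u]]) (use dderiv_eqI[OF D] in simp)
  then show ?case using D unfolding Ck_on.simps differentiable_def by blast
qed

lemma Ck_on_mult:
  fixes F F' :: "'e::euclidean_space \<Rightarrow> real"
  assumes "open S" "Ck_on k S F" "Ck_on k S F'"
  shows "Ck_on k S (\<lambda>x. F x * F' x)"
  using Ck_on_scaleR[OF assms] by simp

text \<open>The derivative involves \<open>inverse (F x)\<close> again, at one order less, so the
  induction runs with \<open>F\<close> fixed.\<close>

lemma Ck_on_inverse:
  fixes F :: "'e::euclidean_space \<Rightarrow> real"
  assumes "open S" "\<And>x. x \<in> S \<Longrightarrow> F x \<noteq> 0" "Ck_on k S F"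
  shows "Ck_on k S (\<lambda>x. inverse (F x))"
  using assms(3)
proof (induction k)
  case 0
  then show ?case using assms(2) by (auto intro: continuous_on_inverse)
next
  case (Suc k)
  have D: "((\<lambda>x. inverse (F x)) has_derivative
      (\<lambda>u. - (inverse (F x) * dderiv F x u * inverse (F x)))) (at x)"
    if "x \<in> S" for x
    using Suc.prems that assms(2) 
by (intro Deriv.has_derivative_inverse dderiv_works) auto
  have C: "Ck_on k S (\<lambda>x. - (inverse (F x) * dderiv F x u * inverse (F x)))" for u
    using Suc.prems Suc.IH Ck_on_SucD[OF Suc.prems(1)]
    by (intro Ck_on_minus Ck_on_mult assms(1)) auto
  have "Ck_on k S (\<lambda>x. dderiv (\<lambda>x. inverse (F x)) x u)" for u
    by (rule Ck_on_cong[OF assms(1) _ C[of u]]) (use dderiv_eqI[OF D] in simp)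
  then show ?case using D unfolding Ck_on.simps differentiable_def by blast
qed

lemma has_derivative_compose_fst:
  assumes "(F has_derivative F') (at (fst z))"
  shows "((\<lambda>z. F (fst z)) has_derivative (\<lambda>u. F' (fst u))) (at z)"
  by (rule has_derivative_compose[OF has_derivative_fst[OF has_derivative_ident] assms])

lemma has_derivative_compose_snd:
  assumes "(F has_derivative F') (at (snd z))"
  shows "((\<lambda>z. F (snd z)) has_derivative (\<lambda>u. F' (snd u))) (at z)"
  by (rule has_derivative_compose[OF has_derivative_snd[OF has_derivative_ident] assms])

text \<open>Differentiating along \<open>u\<close> gives a derivative of \<open>F\<close> along
  \<open>fst u\<close>, again composed with \<open>fst\<close>. The induction therefore closes
  without a general chain rule for C^k maps.\<close>

lemma Ck_on_compose_fst:
  fixes F :: "'e::euclidean_space \<Rightarrow> 'b::real_normed_vector"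
    and S :: "('e \<times> 'f::euclidean_space) set"
  assumes "open S" "fst ` S \<subseteq> U" "Ck_on k U F"
  shows "Ck_on k S (\<lambda>z. F (fst z))"
  using assms(3)
proof (induction k arbitrary: F)
  case 0
  then show ?case
    using assms(2) by (auto intro!: continuous_on_compose2[of U F] continuous_on_fst continuous_on_id)
next
  case (Suc k)
  have D: "((\<lambda>z. F (fst z)) has_derivative (\<lambda>u. dderiv F (fst z) (fst u))) (at z)" if "z \<in> S" for z
    using Suc.prems that assms(2) 
by (intro has_derivative_compose_fst dderiv_works) auto
  have "Ck_on k S (\<lambda>z. dderiv (\<lambda>z. F (fst z)) z u)" for u
    by (rule Ck_on_cong[OF assms(1) _ Suc.IH[of "\<lambda>x. dderiv F x (fst u)"]])
      (use dderiv_eqI[OF D] Suc.prems in simp_all)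
  then show ?case using D unfolding Ck_on.simps differentiable_def by blast
qed

lemma Ck_on_compose_snd:
  fixes F :: "'e::euclidean_space \<Rightarrow> 'b::real_normed_vector"
    and S :: "('f::euclidean_space \<times> 'e) set"
  assumes "open S" "snd ` S \<subseteq> U" "Ck_on k U F"
  shows "Ck_on k S (\<lambda>z. F (snd z))"
  using assms(3)
proof (induction k arbitrary: F)
  case 0
  then show ?case
    using assms(2) by (auto intro!: continuous_on_compose2[of U F] continuous_on_snd continuous_on_id)
next
  case (Suc k)
  have D: "((\<lambda>z. F (snd z)) has_derivative (\<lambda>u. dderiv F (snd z) (snd u))) (at z)" if "z \<in> S" for z
    using Suc.prems that assms(2) 
by (intro has_derivative_compose_snd dderiv_works) auto
  have "Ck_on k S (\<lambda>z. dderiv (\<lambda>z. F (snd z)) z u)" for u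
    by (rule Ck_on_cong[OF assms(1) _ Suc.IH[of "\<lambda>x. dderiv F x (snd u)"]])
      (use dderiv_eqI[OF D] Suc.prems in simp_all)
  then show ?case using D unfolding Ck_on.simps differentiable_def by blast
qed

lemma smooth_on_differentiable: "smooth_on S F \<Longrightarrow> x \<in> S \<Longrightarrow> F differentiable (at x)"
  unfolding smooth_on_def by (metis Ck_on.simps(2))

lemma smooth_on_dderiv: "smooth_on S F \<Longrightarrow> smooth_on S (\<lambda>x. dderiv F x u)"
  unfolding smooth_on_def by (metis Ck_on.simps(2))

lemma smooth_on_has_derivative: "smooth_on S F \<Longrightarrow> x \<in> S \<Longrightarrow> (F has_derivative dderiv F x) (at x)"
  by (intro dderiv_works smooth_on_differentiable)

lemma smooth_on_cong:
  "open S \<Longrightarrow> (\<And>y. y \<in> S \<Longrightarrow> F y = F' y) \<Longrightarrow> smooth_on S F \<Longrightarrow> smooth_on S F'"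
  unfolding smooth_on_def by (meson Ck_on_cong)

text \<open>The factor \<open>a\<close> need not be differentiable, because \<open>c\<close> vanishes at \<open>x\<close>.\<close>

lemma has_derivative_mult_vanishing:
  fixes a c :: "'e::euclidean_space \<Rightarrow> real"
  assumes a: "isCont a x" and c: "(c has_derivative c') (at x)" and c0: "c x = 0"
  shows "((\<lambda>y. a y * c y) has_derivative (\<lambda>u. a x * c' u)) (at x)"
proof -
  \<comment> \<open>Since \<open>c\<close> vanishes at \<open>x\<close> and is differentiable there,
    it is bounded near \<open>x\<close> by a multiple of the distance.\<close>
  obtain d K where d: "d > 0" and K: "\<And>y. norm (y - x) < d \<Longrightarrow> norm (c y) \<le> K * norm (y - x)"
  proof -
    have bl: "bounded_linear c'" using c has_derivative_bounded_linear by blast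
    obtain B where B: "\<And>u. norm (c' u) \<le> norm u * B"
      using bounded_linear.bounded[OF bl] by blast
    obtain d where d: "d > 0"
      "\<And>y. norm (y - x) < d \<Longrightarrow> norm (c y - c x - c' (y - x)) \<le> 1 * norm (y - x)"
      using c unfolding has_derivative_at_alt by (meson zero_less_one)
    have "norm (c y) \<le> (1 + B) * norm (y - x)" if "norm (y - x) < d" for y
    proof -
      have "norm (c y) \<le> norm (c y - c x - c' (y - x)) + norm (c' (y - x))"
        using c0 norm_triangle_sub[of "c y" "c' (y - x)"] by simp
      also have "\<dots> \<le> 1 * norm (y - x) + norm (y - x) * B"
        using d(2)[OF that] B[of "y - x"] by linarith
      finally show ?thesis by (simp add: algebra_simps)
    qed
    with d(1) show ?thesis using that by blast
  qed
  \<comment> \<open>Split \<open>a y * c y\<close> into \<open>(a y - a x) * c y\<close> and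
    \<open>a x * c y\<close>. The first part is \<open>o(norm (y - x))\<close> by continuity of
    \<open>a\<close> and the linear bound on \<open>c\<close>.\<close>
  have "((\<lambda>y. (a y - a x) * c y) has_derivative (\<lambda>u. 0)) (at x)"
  proof (rule has_derivativeI_sandwich[OF d])
    show "bounded_linear (\<lambda>u::'e. 0::real)" by simp
    show "norm ((a y - a x) * c y - (a x - a x) * c x - 0) / norm (y - x) \<le> \<bar>a y - a x\<bar> * K"
      if "y \<noteq> x" "dist y x < d" for y
      using that mult_left_mono[OF K[of y], of "\<bar>a y - a x\<bar>"]
      by (simp add: dist_norm divide_le_eq abs_mult flip: left_diff_distrib)
    have "((\<lambda>y. \<bar>a y - a x\<bar> * K) \<longlongrightarrow> \<bar>a x - a x\<bar> * K) (at x)"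
      using a by (intro tendsto_intros) (simp add: isCont_def)
    then show "((\<lambda>y. \<bar>a y - a x\<bar> * K) \<longlongrightarrow> 0) (at x)" by simp
  qed
  from has_derivative_add[OF this has_derivative_mult_right[OF c, of "a x"]]
  show ?thesis by (simp add: algebra_simps)
qed

lemma linear_eq_Basis_sum:
  assumes "linear L"
  shows "L w = (\<Sum>b\<in>Basis. (w \<bullet> b) *\<^sub>R L b)"
proof -
  have "L w = L (\<Sum>b\<in>Basis. (w \<bullet> b) *\<^sub>R b)"
    by (simp add: euclidean_representation)
  also have "\<dots> = (\<Sum>b\<in>Basis. (w \<bullet> b) *\<^sub>R L b)"
    using assms by (simp add: linear_sum linear_scale)
  finally show ?thesis .
qed

section \<open>Metrics in coordinates\<close>

locale coord_metric =
  fixes U :: "'e::euclidean_space set" and G :: "'e \<Rightarrow> 'e \<Rightarrow> 'e \<Rightarrow> real"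
  assumes open_dom: "open U"
    and bilin: "x \<in> U \<Longrightarrow> bilinear (G x)"
    and sym: "x \<in> U \<Longrightarrow> G x u v = G x v u"
    and nondeg: "x \<in> U \<Longrightarrow> (\<And>v. G x u v = 0) \<Longrightarrow> u = 0"
    and smooth: "smooth_on U (\<lambda>x. G x u v)"
begin

lemma linear_left: "x \<in> U \<Longrightarrow> linear (\<lambda>u. G x u v)"
  using bilin by (simp add: bilinear_def)

lemma linear_right: "x \<in> U \<Longrightarrow> linear (G x u)"
  using bilin by (simp add: bilinear_def eta_contract_eq)

lemma left_simps:
  assumes "x \<in> U"
  shows "G x (u + u') v = G x u v + G x u' v" "G x (u - u') v = G x u v - G x u' v"
    "G x (c *\<^sub>R u) v = c * G x u v" "G x (- u) v = - G x u v"
    "G x 0 v = 0"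
  using assms bilin
  by (auto simp: bilinear_ladd bilinear_lsub bilinear_lmul bilinear_lneg bilinear_lzero)

lemma right_simps:
  assumes "x \<in> U"
  shows "G x u (v + v') = G x u v + G x u v'" "G x u (v - v') = G x u v - G x u v'"
    "G x u (c *\<^sub>R v) = c * G x u v" "G x u (- v) = - G x u v"
    "G x u 0 = 0"
  using assms bilin
  by (auto simp: bilinear_radd bilinear_rsub bilinear_rmul bilinear_rneg bilinear_rzero)

lemma left_Basis_sum: "x \<in> U \<Longrightarrow> G x u v = (\<Sum>b\<in>Basis. (u \<bullet> b) * G x b v)"
  using linear_eq_Basis_sum[OF linear_left, of x u v] by simp

section \<open>Lowering an index, and the regularity of solutions of linear equations in the
  metric\<close>

definition flat :: "'e \<Rightarrow> 'e \<Rightarrow> 'e" where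
  "flat x z = (\<Sum>b\<in>Basis. G x z b *\<^sub>R b)"

lemma flat_inner: "b \<in> Basis \<Longrightarrow> flat x z \<bullet> b = G x z b"
  by (simp add: flat_def inner_sum_left_Basis)

lemma linear_flat:
  assumes "x \<in> U"
  shows "linear (flat x)"
  by (rule linearI; rule euclidean_eqI) (simp_all add: flat_inner inner_left_distrib left_simps assms)

lemma eq_on_Basis:
  assumes "x \<in> U" "linear L" "\<And>b. b \<in> Basis \<Longrightarrow> G x z b = L b"
  shows "G x z w = L w"
  by (rule linear_eq_on[OF linear_right[OF assms(1)] assms(2), of w Basis])
    (use assms(3) in \<open>auto simp: span_Basis\<close>)

text \<open>Nondegeneracy says that a vector with zero covector is zero; \<open>flat\<close> stores
  the covector by its values on the Euclidean basis, which makes it an endomorphism.\<close>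

lemma inj_flat:
  assumes "x \<in> U"
  shows "inj (flat x)"
  unfolding linear_injective_0[OF linear_flat[OF assms]]
proof (intro allI impI)
  fix u assume "flat x u = 0"
  then have "G x u b = 0" if "b \<in> Basis" for b
    using flat_inner[OF that, of x u] by simp
  then have "G x u w = 0" for w
    by (rule eq_on_Basis[OF assms linear_zero])
  then show "u = 0" using nondeg[OF assms] by blast
qed

text \<open>An injective endomorphism in finite dimension is onto, so every covector comes from one
  vector. This gives meaning to the definite descriptions in \<open>christoffel\<close> and
  \<open>grad\<close>.\<close>

lemma solve_ex1:
  assumes "x \<in> U" "linear L"
  shows "\<exists>!z. \<forall>w. G x z w = L w"
proof -
  have "surj (flat x)"
    using linear_injective_imp_surjective[OF linear_flat inj_flat] assms by blast
  then obtain z where z: "flat x z = (\<Sum>b\<in>Basis. L b *\<^sub>R b)"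
    by (metis surjD)
  have "G x z b = L b" if "b \<in> Basis" for b
    using flat_inner[OF that, of x z] that by (simp add: z inner_sum_left_Basis)
  then have "\<forall>w. G x z w = L w"
    using eq_on_Basis[OF assms] by blast
  moreover have "z' = z" if "\<forall>w. G x z' w = L w" for z'
  proof -
    have "G x (z' - z) w = 0" for w
      using that calculation by (simp add: left_simps assms)
    then show ?thesis using nondeg[OF assms(1), of "z' - z"] by simp
  qed
  ultimately show ?thesis by blast
qed

text \<open>No inverse matrix is formed: the fixed map \<open>flat x\<close> is bounded below, and
  \<open>z y - z x\<close> is estimated by comparing the equation at \<open>y\<close> with the
  metric frozen at \<open>x\<close>.\<close>

lemma solve_continuous:
  assumes "x \<in> U" "\<And>y w. y \<in> U \<Longrightarrow> G y (z y) w = L y w"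
    and "\<And>w. isCont (\<lambda>y. L y w) x"
  shows "isCont z x"
proof -
  obtain B where B: "B > 0" "\<And>v. B * norm v \<le> norm (flat x v)"
    using linear_inj_bounded_below_pos[OF linear_flat inj_flat] assms(1) by metis
  \<comment> \<open>Here \<open>\<epsilon>\<close> measures how far the metric has moved from
    \<open>x\<close>, and \<open>r\<close> how badly \<open>z x\<close> solves the equation at
    \<open>y\<close>. Both tend to 0.\<close>
  define \<epsilon> where "\<epsilon> y = (\<Sum>b\<in>Basis. \<Sum>b'\<in>Basis. \<bar>G y b' b - G x b' b\<bar>)" for y
  define r where "r y = (\<Sum>b\<in>Basis. \<bar>L y b - G y (z x) b\<bar>)" for y
  have contG: "isCont (\<lambda>y. G y u v) x" for u v
    using smooth_on_differentiable[OF smooth assms(1)] differentiable_imp_continuous_within by blast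
  have "isCont \<epsilon> x" unfolding \<epsilon>_def by (intro continuous_intros contG)
  then have "\<epsilon> \<midarrow>x\<rightarrow> \<epsilon> x" by (simp add: isCont_def)
  then have \<epsilon>: "\<epsilon> \<midarrow>x\<rightarrow> 0" by (simp add: \<epsilon>_def)
  have "isCont r x" unfolding r_def by (intro continuous_intros contG assms(3))
  then have "r \<midarrow>x\<rightarrow> r x" by (simp add: isCont_def)
  then have r: "r \<midarrow>x\<rightarrow> 0" using assms(1,2) by (simp add: r_def)
  have bound: "B * norm (z y - z x) \<le> r y + norm (z y - z x) * \<epsilon> y" if y: "y \<in> U" for y
  proof -
    let ?d = "z y - z x"
    have "B * norm ?d \<le> norm (flat x ?d)" using B by blast
    also have "\<dots> \<le> (\<Sum>b\<in>Basis. \<bar>flat x ?d \<bullet> b\<bar>)" by (rule norm_le_l1)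
    also have "\<dots> \<le> (\<Sum>b\<in>Basis. \<bar>L y b - G y (z x) b\<bar> + norm ?d * (\<Sum>b'\<in>Basis. \<bar>G y b' b - G x b' b\<bar>))"
    proof (rule sum_mono)
      fix b :: 'e assume b: "b \<in> Basis"
      have e: "G x ?d b = (L y b - G y (z x) b) - (G y ?d b - G x ?d b)"
        using assms(2)[OF y] by (simp add: left_simps y)
      have "\<bar>G y ?d b - G x ?d b\<bar> = \<bar>\<Sum>b'\<in>Basis. (?d \<bullet> b') * (G y b' b - G x b' b)\<bar>"
        unfolding left_Basis_sum[OF y, of ?d] left_Basis_sum[OF assms(1), of ?d]
        by (simp add: sum_subtractf right_diff_distrib)
      also have "\<dots> \<le> (\<Sum>b'\<in>Basis. \<bar>(?d \<bullet> b') * (G y b' b - G x b' b)\<bar>)"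
        by (rule sum_abs)
      also have "\<dots> \<le> (\<Sum>b'\<in>Basis. norm ?d * \<bar>G y b' b - G x b' b\<bar>)"
        by (intro sum_mono) (simp add: abs_mult mult_right_mono Basis_le_norm)
      finally have "\<bar>G y ?d b - G x ?d b\<bar> \<le> norm ?d * (\<Sum>b'\<in>Basis. \<bar>G y b' b - G x b' b\<bar>)"
        by (simp add: sum_distrib_left)
      then show "\<bar>flat x ?d \<bullet> b\<bar> \<le>
          \<bar>L y b - G y (z x) b\<bar> + norm ?d * (\<Sum>b'\<in>Basis. \<bar>G y b' b - G x b' b\<bar>)"
        using flat_inner[OF b, of x ?d] e by linarith
    qed
    also have "\<dots> = r y + norm ?d * \<epsilon> y"
      by (simp add: r_def \<epsilon>_def sum.distrib sum_distrib_left)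
    finally show ?thesis .
  qed
  \<comment> \<open>Once \<open>\<epsilon> y\<close> is below \<open>B / 2\<close>, the last term of
    \<open>bound\<close> is absorbed into the left side, leaving \<open>2 / B * r y\<close>.\<close>
  have "eventually (\<lambda>y. \<epsilon> y < B / 2) (at x)"
    using order_tendstoD(2)[OF \<epsilon>, of "B/2"] B by simp
  moreover have "eventually (\<lambda>y. y \<in> U) (at x)"
    using open_dom assms(1) eventually_at_topological by blast
  ultimately have "eventually (\<lambda>y. norm (z y - z x) \<le> 2 / B * r y) (at x)"
  proof eventually_elim
    case (elim y)
    have "norm (z y - z x) * \<epsilon> y \<le> norm (z y - z x) * (B / 2)"
      using elim by (intro mult_left_mono) auto
    then show ?case
      using bound[OF elim(2)] B by (simp add: field_simps)
  qed
  moreover have "(\<lambda>y. 2 / B * r y) \<midarrow>x\<rightarrow> 0"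
    using tendsto_mult_right_zero[OF r] by blast
  ultimately have "(\<lambda>y. norm (z y - z x)) \<midarrow>x\<rightarrow> 0"
    by (rule tendsto_sandwich[OF always_eventually[OF allI[OF norm_ge_zero]] _ tendsto_const])
  then have "(\<lambda>y. z y - z x) \<midarrow>x\<rightarrow> 0"
    by (rule tendsto_norm_zero_cancel)
  then show ?thesis
    by (simp add: isCont_def LIM_zero_iff)
qed

text \<open>Freezing the metric at \<open>x\<close> turns the equation into
  \<open>flat x (z y) = H y\<close>. In \<open>H\<close> the unknown \<open>z\<close> occurs only
  multiplied by \<open>G y - G x\<close>, which vanishes at \<open>x\<close>, so continuity of
  \<open>z\<close> is enough to differentiate \<open>H\<close>.\<close>

lemma solve_differentiable:
  assumes "x \<in> U" "\<And>y w. y \<in> U \<Longrightarrow> G y (z y) w = L y w"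
    and "\<And>w. (\<lambda>y. L y w) differentiable (at x)"
  shows "z differentiable (at x)"
proof -
  have cont: "isCont z x"
    using solve_continuous[OF assms(1,2)] assms(3) differentiable_imp_continuous_within by blast
  have diffG: "((\<lambda>y. G y u v) has_derivative dderiv (\<lambda>y. G y u v) x) (at x)" for u v
    using smooth_on_has_derivative[OF smooth assms(1)] .
  have summand: "((\<lambda>y. (z y \<bullet> b') * (G y b' b - G x b' b)) has_derivative
      (\<lambda>u. (z x \<bullet> b') * (dderiv (\<lambda>y. G y b' b) x u - 0))) (at x)" for b b'
    by (intro has_derivative_mult_vanishing has_derivative_diff diffG has_derivative_const
        continuous_intros cont) simp
  define H where "H y = (\<Sum>b\<in>Basis. (L y b - (\<Sum>b'\<in>Basis. (z y \<bullet> b') * (G y b' b - G x b' b))) *\<^sub>R b)"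
    for y
  have "(\<lambda>y. L y b - (\<Sum>b'\<in>Basis. (z y \<bullet> b') * (G y b' b - G x b' b))) differentiable (at x)" for b
    using summand
    by (intro differentiable_diff differentiable_sum finite_Basis assms(3) ballI)
       (auto simp: differentiable_def)
  then have "H differentiable (at x)"
    unfolding H_def by (intro differentiable_sum differentiable_scaleR) auto
  moreover have eq: "flat x (z y) = H y" if y: "y \<in> U" for y
  proof -
    have "G x (z y) b = L y b - (\<Sum>b'\<in>Basis. (z y \<bullet> b') * (G y b' b - G x b' b))" for b
      using assms(2)[OF y, of b] left_Basis_sum[OF y, of "z y" b] left_Basis_sum[OF assms(1), of "z y" b]
      by (simp add: sum_subtractf right_diff_distrib)
    then show ?thesis by (simp add: flat_def H_def)
  qed
  obtain S where S: "linear S" "S \<circ> flat x = id"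
    using linear_injective_left_inverse[OF linear_flat inj_flat] assms(1) by blast
  ultimately have "(\<lambda>y. S (H y)) differentiable (at x)"
    unfolding differentiable_def
    using bounded_linear.has_derivative[OF linear_conv_bounded_linear[THEN iffD1, OF S(1)]] by blast
  moreover have "S (H y) = z y" if "y \<in> U" for y
    using eq[OF that] S(2) by (metis comp_apply id_apply)
  ultimately show ?thesis
    using differentiable_cong_open[OF open_dom assms(1), of "\<lambda>y. S (H y)" z] by blast
qed

text \<open>Differentiating \<open>G y (z y) w = L y w\<close> shows that the derivative of \<open>z\<close> solves an equation
  of the same form, which drives the induction on \<open>k\<close>.\<close>

lemma solve_Ck:
  assumes "\<And>x w. x \<in> U \<Longrightarrow> G x (z x) w = L x w" "\<And>w. Ck_on k U (\<lambda>x. L x w)"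
  shows "Ck_on k U z"
  using assms
proof (induction k arbitrary: z L)
  case 0
  have "isCont z x" if "x \<in> U" for x
    using solve_continuous[OF that 0(1)] 0(2) open_dom that
    by (auto simp: continuous_on_eq_continuous_at)
  then show ?case
    by (simp add: continuous_at_imp_continuous_on)
next
  case (Suc k)
  have D: "z differentiable (at x)" if "x \<in> U" for x
    using solve_differentiable[OF that Suc.prems(1)] Suc.prems(2) that by auto
  \<comment> \<open>The equation for the derivative of \<open>z\<close> contains \<open>z\<close>
    itself, so order \<open>k\<close> for \<open>z\<close> is secured first, from the original
    equation.\<close>
  have z: "Ck_on k U z"
    using Suc.IH[of z L] Suc.prems Ck_on_SucD by blast
  have eq: "G x (dderiv z x u) w =
      dderiv (\<lambda>y. L y w) x u - (\<Sum>b\<in>Basis. (z x \<bullet> b) * dderiv (\<lambda>y. G y b w) x u)"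
    if x: "x \<in> U" for x u w
  proof -
    \<comment> \<open>Expanding \<open>z y\<close> in the basis separates the dependence on
      \<open>y\<close> through the metric from that through \<open>z\<close>, so the product rule
      applies.\<close>
    have "((\<lambda>y. \<Sum>b\<in>Basis. (z y \<bullet> b) * G y b w) has_derivative
       (\<lambda>u. \<Sum>b\<in>Basis. (z x \<bullet> b) * dderiv (\<lambda>y. G y b w) x u + (dderiv z x u \<bullet> b) * G x b w)) (at x)"
      by (intro has_derivative_sum has_derivative_mult has_derivative_inner_left dderiv_works D x
          smooth_on_differentiable[OF smooth])
    then have "dderiv (\<lambda>y. \<Sum>b\<in>Basis. (z y \<bullet> b) * G y b w) x u =
        (\<Sum>b\<in>Basis. (z x \<bullet> b) * dderiv (\<lambda>y. G y b w) x u + (dderiv z x u \<bullet> b) * G x b w)"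
      by (rule dderiv_eqI)
    moreover have "dderiv (\<lambda>y. \<Sum>b\<in>Basis. (z y \<bullet> b) * G y b w) x u = dderiv (\<lambda>y. L y w) x u"
      by (rule dderiv_cong[OF open_dom x]) (use Suc.prems(1) left_Basis_sum in metis)
    ultimately show ?thesis
      using left_Basis_sum[OF x, of "dderiv z x u" w] by (simp add: sum.distrib)
  qed
  have "Ck_on k U (\<lambda>x. dderiv z x u)" for u
  proof (rule Suc.IH[OF eq])
    have "Ck_on k U (\<lambda>x. dderiv (\<lambda>y. G y b w) x u)" for b w
      using smooth_on_dderiv[OF smooth] by (simp add: smooth_on_def)
    then show "Ck_on k U (\<lambda>x. dderiv (\<lambda>y. L y w) x u -
        (\<Sum>b\<in>Basis. (z x \<bullet> b) * dderiv (\<lambda>y. G y b w) x u))" for w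
      using Suc.prems(2)
      by (intro Ck_on_diff Ck_on_sum Ck_on_mult Ck_on_linear[OF _ bounded_linear_inner_left z]
          open_dom) auto
  qed
  then show ?case using D by simp
qed

lemma solve_smooth:
  assumes "\<And>x w. x \<in> U \<Longrightarrow> G x (z x) w = L x w" "\<And>w. smooth_on U (\<lambda>x. L x w)"
  shows "smooth_on U z"
  unfolding smooth_on_def using solve_Ck[of z L, OF assms(1)] assms(2) smooth_on_def by blast

section \<open>The Levi-Civita connection and curvature in coordinates\<close>

definition koszul :: "'e \<Rightarrow> 'e \<Rightarrow> 'e \<Rightarrow> 'e \<Rightarrow> real" where
  "koszul x u v w =
     dderiv (\<lambda>y. G y v w) x u + dderiv (\<lambda>y. G y u w) x v - dderiv (\<lambda>y. G y u v) x w"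

lemma dderiv_metric_linear_right:
  assumes "x \<in> U"
  shows "linear (\<lambda>w. dderiv (\<lambda>y. G y v w) x u)"
proof (rule linearI)
  have D: "((\<lambda>y. G y v w) has_derivative dderiv (\<lambda>y. G y v w) x) (at x)" for w
    using smooth_on_has_derivative[OF smooth assms] .
  show "dderiv (\<lambda>y. G y v (w + w')) x u = dderiv (\<lambda>y. G y v w) x u + dderiv (\<lambda>y. G y v w') x u"
    for w w'
    using dderiv_cong[OF open_dom assms, of "\<lambda>y. G y v (w + w')" "\<lambda>y. G y v w + G y v w'"]
      dderiv_eqI[OF has_derivative_add[OF D[of w] D[of w']]] right_simps by simp
  show "dderiv (\<lambda>y. G y v (c *\<^sub>R w)) x u = c *\<^sub>R dderiv (\<lambda>y. G y v w) x u" for c w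
    using dderiv_cong[OF open_dom assms, of "\<lambda>y. G y v (c *\<^sub>R w)" "\<lambda>y. c * G y v w"]
      dderiv_eqI[OF has_derivative_mult_right[OF D[of w], of c]] right_simps by simp
qed

lemma dderiv_metric_sym:
  assumes "x \<in> U"
  shows "dderiv (\<lambda>y. G y v w) x u = dderiv (\<lambda>y. G y w v) x u"
  by (rule dderiv_cong[OF open_dom assms]) (rule sym)

lemma dderiv_metric_linear_left:
  assumes "x \<in> U"
  shows "linear (\<lambda>w. dderiv (\<lambda>y. G y w v) x u)"
proof -
  have "(\<lambda>w. dderiv (\<lambda>y. G y w v) x u) = (\<lambda>w. dderiv (\<lambda>y. G y v w) x u)"
    by (rule ext) (rule dderiv_metric_sym[OF assms])
  then show ?thesis using dderiv_metric_linear_right[OF assms] by metis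
qed

lemma dderiv_metric_linear_dir:
  assumes "x \<in> U"
  shows "linear (\<lambda>u. dderiv (\<lambda>y. G y v w) x u)"
  using linear_dderiv[OF smooth_on_differentiable[OF smooth assms]] by (simp add: eta_contract_eq)

lemma koszul_linear_right: "x \<in> U \<Longrightarrow> linear (koszul x u v)"
  unfolding koszul_def
  by (intro linear_compose_add linear_compose_sub dderiv_metric_linear_right dderiv_metric_linear_dir)

lemma koszul_linear_middle: "x \<in> U \<Longrightarrow> linear (\<lambda>v. koszul x u v w)"
  unfolding koszul_def
  by (intro linear_compose_add linear_compose_sub dderiv_metric_linear_right
      dderiv_metric_linear_left dderiv_metric_linear_dir)

lemma koszul_ex1:
  assumes "x \<in> U"
  shows "\<exists>!z. \<forall>w. 2 * G x z w = koszul x u v w"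
proof -
  have "linear (\<lambda>w. (1/2) *\<^sub>R koszul x u v w)"
    by (rule linear_compose_scale_right[OF koszul_linear_right[OF assms]])
  from solve_ex1[OF assms this]
  show ?thesis by (simp add: field_simps)
qed

lemma christoffel_koszul:
  assumes "x \<in> U"
  shows "2 * G x (christoffel G x u v) w = koszul x u v w"
  using theI'[OF koszul_ex1[OF assms, of u v]] unfolding christoffel_def koszul_def by blast

text \<open>Uniqueness in the Koszul formula reduces identities between Christoffel vectors to
  checking that a candidate satisfies it.\<close>

lemma christoffel_eqI:
  assumes "x \<in> U" "\<And>w. 2 * G x z w = koszul x u v w"
  shows "christoffel G x u v = z"
  using koszul_ex1[OF assms(1), of u v] assms(2) christoffel_koszul[OF assms(1), of u v] by blast

lemma christoffel_linear:
  assumes "x \<in> U"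
  shows "linear (christoffel G x u)"
proof (rule linearI; rule christoffel_eqI[OF assms])
  show "2 * G x (christoffel G x u v + christoffel G x u v') w = koszul x u (v + v') w" for v v' w
    using linear_add[OF koszul_linear_middle[OF assms, of u w], of v v']
    by (simp add: left_simps assms christoffel_koszul distrib_left)
  show "2 * G x (c *\<^sub>R christoffel G x u v) w = koszul x u (c *\<^sub>R v) w" for v c w
    using linear_scale[OF koszul_linear_middle[OF assms, of u w], of c v]
    by (simp add: left_simps assms christoffel_koszul[symmetric])
qed

text \<open>Torsion-freeness for commuting constant fields: swapping \<open>u\<close> and
  \<open>v\<close> exchanges the first two terms of \<open>koszul\<close>, and symmetry of the
  metric preserves the third.\<close>

lemma christoffel_sym:
  assumes "x \<in> U"
  shows "christoffel G x u v = christoffel G x v u"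
proof (rule christoffel_eqI[OF assms])
  show "2 * G x (christoffel G x v u) w = koszul x u v w" for w
    using christoffel_koszul[OF assms, of v u w] dderiv_metric_sym[OF assms, of u v w]
    by (simp add: koszul_def)
qed

lemma christoffel_zero:
  assumes "x \<in> U"
  shows "christoffel G x u 0 = 0" "christoffel G x 0 u = 0"
  using linear_0[OF christoffel_linear[OF assms, of u]] christoffel_sym[OF assms, of u 0] by simp_all

text \<open>The Koszul formula determines the Christoffel vector only implicitly; its right-hand
  side is smooth in the point, so \<open>solve_smooth\<close> applies.\<close>

lemma christoffel_smooth: "smooth_on U (\<lambda>x. christoffel G x u v)"
proof (rule solve_smooth)
  show "G x (christoffel G x u v) w = (1/2) * koszul x u v w" if "x \<in> U" for x w
    using christoffel_koszul[OF that, of u v w] by simp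
  have "Ck_on k U (\<lambda>x. dderiv (\<lambda>y. G y v w) x u)" for k u v w
    using smooth_on_dderiv[OF smooth] by (simp add: smooth_on_def)
  then show "smooth_on U (\<lambda>x. (1/2) * koszul x u v w)" for w
    unfolding koszul_def smooth_on_def
    by (intro allI Ck_on_mult Ck_on_const Ck_on_add Ck_on_diff open_dom)
qed

lemma curvature_smooth: "smooth_on U (\<lambda>x. curvature G x u v w)"
proof -
  have C: "Ck_on k U (\<lambda>x. christoffel G x u v)" for k u v
    using christoffel_smooth by (simp add: smooth_on_def)
  have D: "Ck_on k U (\<lambda>x. dderiv (\<lambda>y. christoffel G y v w) x u)" for k u v w
    using smooth_on_dderiv[OF christoffel_smooth] by (simp add: smooth_on_def)
  \<comment> \<open>The inner Christoffel vector varies with \<open>x\<close>; linearity in the last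
    argument reduces to constant basis vectors with smooth coefficients.\<close>
  have CC: "Ck_on k U (\<lambda>x. christoffel G x u (christoffel G x v w))" for k u v w
  proof (rule Ck_on_cong[OF open_dom])
    show "Ck_on k U (\<lambda>x. \<Sum>b\<in>Basis. (christoffel G x v w \<bullet> b) *\<^sub>R christoffel G x u b)"
      by (intro Ck_on_sum Ck_on_scaleR Ck_on_linear[OF _ bounded_linear_inner_left] C open_dom)
  qed (use linear_eq_Basis_sum[OF christoffel_linear] in metis)
  show ?thesis
    unfolding curvature_def smooth_on_def
    by (intro allI Ck_on_add Ck_on_diff C D CC open_dom)
qed

lemma ricci_smooth: "smooth_on U (\<lambda>x. ricci G x v w)"
proof -
  have "Ck_on k U (\<lambda>x. curvature G x u v w)" for k u
    using curvature_smooth by (simp add: smooth_on_def)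
  then show ?thesis
    unfolding ricci_def trace_op_def smooth_on_def
    by (intro allI Ck_on_sum Ck_on_linear[OF _ bounded_linear_inner_left] open_dom)
qed

lemma einstein_factor_smooth:
  assumes "\<And>x v w. x \<in> U \<Longrightarrow> ricci G x v w = c x * G x v w"
  shows "smooth_on U c"
  unfolding smooth_on_def
proof (intro allI Ck_on_local)
  fix k x assume x: "x \<in> U"
  obtain b :: 'e where "b \<in> Basis" using nonempty_Basis by blast
  then have "b \<noteq> 0" by auto
  \<comment> \<open>With an indefinite metric \<open>G x b b\<close> may vanish, so nondegeneracy
    supplies a partner \<open>v\<close> for \<open>b\<close>; the pairing stays nonzero on an open
    set around \<open>x\<close>.\<close>
  then obtain v where v: "G x b v \<noteq> 0" using nondeg[OF x] by blast
  let ?W = "U \<inter> (\<lambda>y. G y b v) -` (- {0})"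
  have "continuous_on U (\<lambda>y. G y b v)"
    using smooth unfolding smooth_on_def by (metis Ck_on.simps(1))
  then have W: "open ?W"
    by (rule continuous_open_preimage[OF _ open_dom]) auto
  have "Ck_on k ?W (\<lambda>y. ricci G y b v)" "Ck_on k ?W (\<lambda>y. G y b v)"
    using ricci_smooth smooth unfolding smooth_on_def by (blast intro: Ck_on_subset)+
  then have "Ck_on k ?W (\<lambda>y. ricci G y b v * inverse (G y b v))"
    by (intro Ck_on_mult Ck_on_inverse W) auto
  then have "Ck_on k ?W c"
    by (rule Ck_on_cong[OF W, rotated]) (use assms in auto)
  then show "\<exists>W. open W \<and> x \<in> W \<and> Ck_on k W c"
    using W x v by blast
qed

end

section \<open>Locality of the coordinate expressions, and derivatives through the
  projections\<close>

lemma christoffel_cong: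
  assumes "open S" "x \<in> S" "\<And>y. y \<in> S \<Longrightarrow> G y = G' y"
  shows "christoffel G x u v = christoffel G' x u v"
proof -
  have "dderiv (\<lambda>y. G y a b) x d = dderiv (\<lambda>y. G' y a b) x d" for a b d
    by (rule dderiv_cong[OF assms(1,2)]) (simp add: assms(3))
  then show ?thesis
    unfolding christoffel_def by (simp add: assms)
qed

text \<open>The metric in a product chart is identified with \<open>wprod\<close> only on the chart
  image. Openness of that image lets the derivatives be compared too.\<close>

lemma ricci_cong:
  assumes "open S" "x \<in> S" "\<And>y. y \<in> S \<Longrightarrow> G y = G' y"
  shows "ricci G x v w = ricci G' x v w"
proof -
  have c: "christoffel G y a b = christoffel G' y a b" if "y \<in> S" for y a b
    using christoffel_cong[OF assms(1) that assms(3)] .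
  have "dderiv (\<lambda>y. christoffel G y a b) x d = dderiv (\<lambda>y. christoffel G' y a b) x d" for a b d
    by (rule dderiv_cong[OF assms(1,2) c])
  then show ?thesis
    unfolding ricci_def curvature_def by (simp add: c assms(2))
qed

lemma hessian_cong:
  assumes "open S" "x \<in> S" "\<And>y. y \<in> S \<Longrightarrow> G y = G' y" "\<And>y. y \<in> S \<Longrightarrow> F y = F' y"
  shows "hessian G F x u v = hessian G' F' x u v"
proof -
  have d: "dderiv F y a = dderiv F' y a" if "y \<in> S" for y a
    using dderiv_cong[OF assms(1) that assms(4)] .
  have "dderiv (\<lambda>y. dderiv F y v) x u = dderiv (\<lambda>y. dderiv F' y v) x u"
    by (rule dderiv_cong[OF assms(1,2) d])
  then show ?thesis
    unfolding hessian_def using d[OF assms(2)] christoffel_cong[OF assms(1-3)] by simp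
qed

lemma dderiv_compose_fst:
  assumes "F differentiable (at (fst z))"
  shows "dderiv (\<lambda>z. F (fst z)) z u = dderiv F (fst z) (fst u)"
  by (rule dderiv_eqI[OF has_derivative_compose_fst[OF dderiv_works[OF assms]]])

lemma dderiv_compose_snd:
  assumes "F differentiable (at (snd z))"
  shows "dderiv (\<lambda>z. F (snd z)) z u = dderiv F (snd z) (snd u)"
  by (rule dderiv_eqI[OF has_derivative_compose_snd[OF dderiv_works[OF assms]]])

lemma fst_dderiv:
  assumes "F differentiable (at x)"
  shows "fst (dderiv F x u) = dderiv (\<lambda>y. fst (F y)) x u"
  by (rule dderiv_eqI[symmetric]) (intro has_derivative_fst dderiv_works assms)

lemma snd_dderiv:
  assumes "F differentiable (at x)"
  shows "snd (dderiv F x u) = dderiv (\<lambda>y. snd (F y)) x u"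
  by (rule dderiv_eqI[symmetric]) (intro has_derivative_snd dderiv_works assms)

section \<open>Warped products in coordinates\<close>

text \<open>The counterpart of \<open>warped_metric\<close> inside one chart;
  \<open>local_metric_warped\<close> connects the two.\<close>

definition wprod :: "('e \<Rightarrow> 'e \<Rightarrow> 'e \<Rightarrow> real) \<Rightarrow> ('e \<Rightarrow> real) \<Rightarrow> ('f \<Rightarrow> 'f \<Rightarrow> 'f \<Rightarrow> real) \<Rightarrow>
    'e \<times> 'f \<Rightarrow> 'e \<times> 'f \<Rightarrow> 'e \<times> 'f \<Rightarrow> real" where
  "wprod A \<phi> B z u v =
     A (fst z) (fst u) (fst v) + (\<phi> (fst z))\<^sup>2 * B (snd z) (snd u) (snd v)"

locale warped_coord = base: coord_metric U A + fibre: coord_metric V B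
  for U :: "'e::euclidean_space set" and A and V :: "'f::euclidean_space set" and B +
  fixes \<phi> :: "'e \<Rightarrow> real"
  assumes warp_smooth: "smooth_on U \<phi>" and warp_pos: "x \<in> U \<Longrightarrow> \<phi> x > 0"
begin

abbreviation W :: "'e \<times> 'f \<Rightarrow> 'e \<times> 'f \<Rightarrow> 'e \<times> 'f \<Rightarrow> real" where
  "W \<equiv> wprod A \<phi> B"

lemma warp_Ck: "Ck_on k U \<phi>"
  using warp_smooth by (simp add: smooth_on_def)

lemma open_prod: "open (U \<times> V)"
  by (intro open_Times base.open_dom fibre.open_dom)

text \<open>Testing against purely horizontal and purely vertical vectors separates the blocks, so
  nondegeneracy is inherited; on the fibre block the positive warping factor cancels.\<close>

sublocale prod: coord_metric "U \<times> V" W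
proof
  show "open (U \<times> V)" by (rule open_prod)
  fix z :: "'e \<times> 'f" and u v
  assume z: "z \<in> U \<times> V"
  then have z1: "fst z \<in> U" and z2: "snd z \<in> V" by auto
  note simps = base.left_simps[OF z1] base.right_simps[OF z1]
    fibre.left_simps[OF z2] fibre.right_simps[OF z2]
  show "bilinear (W z)"
    unfolding bilinear_def
    by (intro allI conjI linearI) (simp_all add: wprod_def simps algebra_simps)
  show "W z u v = W z v u"
    using base.sym[OF z1] fibre.sym[OF z2] by (simp add: wprod_def)
  assume 0: "W z u v = 0" for v
  have "A (fst z) (fst u) a = 0" for a
    using 0[of "(a, 0)"] by (simp add: wprod_def simps)
  moreover have "B (snd z) (snd u) b = 0" for b
    using 0[of "(0, b)"] warp_pos[OF z1] by (simp add: wprod_def simps)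
  ultimately show "u = 0"
    using base.nondeg[OF z1] fibre.nondeg[OF z2] by (simp add: prod_eq_iff)
next
  fix u v :: "'e \<times> 'f"
  have "Ck_on k U (\<lambda>x. A x a b)" "Ck_on k V (\<lambda>y. B y c d)" for k a b c d
    using base.smooth fibre.smooth by (simp_all add: smooth_on_def)
  then show "smooth_on (U \<times> V) (\<lambda>z. W z u v)"
    unfolding wprod_def smooth_on_def power2_eq_square
    by (intro allI Ck_on_add Ck_on_mult open_prod Ck_on_compose_fst[where U=U]
        Ck_on_compose_snd[where U=V] warp_Ck) auto
qed

definition grad :: "'e \<Rightarrow> 'e" where
  "grad x = (THE z. \<forall>w. A x z w = dderiv \<phi> x w)"

lemma grad:
  assumes "x \<in> U"
  shows "A x (grad x) w = dderiv \<phi> x w"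
  using theI'[OF base.solve_ex1[OF assms linear_dderiv[OF smooth_on_differentiable[OF warp_smooth assms]]]]
  unfolding grad_def by blast

lemma grad_smooth: "smooth_on U grad"
  using base.solve_smooth[OF grad] smooth_on_dderiv[OF warp_smooth] by blast

lemma dwarp_linear: "x \<in> U \<Longrightarrow> linear (dderiv \<phi> x)"
  by (intro linear_dderiv smooth_on_differentiable[OF warp_smooth])

section \<open>The Levi-Civita connection of a warped product\<close>

lemma dderiv_wprod:
  assumes "x \<in> U" "y \<in> V"
  shows "dderiv (\<lambda>z. W z v w) (x, y) u =
    dderiv (\<lambda>x. A x (fst v) (fst w)) x (fst u)
    + 2 * \<phi> x * dderiv \<phi> x (fst u) * B y (snd v) (snd w)
    + (\<phi> x)\<^sup>2 * dderiv (\<lambda>y. B y (snd v) (snd w)) y (snd u)"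
proof -
  have \<phi>: "((\<lambda>z. \<phi> (fst z)) has_derivative (\<lambda>u. dderiv \<phi> x (fst u))) (at (x, y))"
    using smooth_on_has_derivative[OF warp_smooth assms(1)] by (intro has_derivative_compose_fst) simp
  have A: "((\<lambda>z. A (fst z) (fst v) (fst w)) has_derivative
      (\<lambda>u. dderiv (\<lambda>x. A x (fst v) (fst w)) x (fst u))) (at (x, y))"
    using smooth_on_has_derivative[OF base.smooth assms(1)] by (intro has_derivative_compose_fst) simp
  have B: "((\<lambda>z. B (snd z) (snd v) (snd w)) has_derivative
      (\<lambda>u. dderiv (\<lambda>y. B y (snd v) (snd w)) y (snd u))) (at (x, y))"
    using smooth_on_has_derivative[OF fibre.smooth assms(2)] by (intro has_derivative_compose_snd) simp
  note D = has_derivative_add[OF A has_derivative_mult[OF has_derivative_mult[OF \<phi> \<phi>] B]]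
  from dderiv_eqI[OF D] show ?thesis
    by (simp add: wprod_def algebra_simps power2_eq_square)
qed

lemma christoffel_wprod:
  assumes "x \<in> U" "y \<in> V"
  shows "christoffel W (x, y) (u, u') (v, v') =
    (christoffel A x u v - (\<phi> x * B y u' v') *\<^sub>R grad x,
     christoffel B y u' v' + (dderiv \<phi> x u / \<phi> x) *\<^sub>R v' + (dderiv \<phi> x v / \<phi> x) *\<^sub>R u')"
proof (rule prod.christoffel_eqI)
  show "(x, y) \<in> U \<times> V" using assms by simp
  fix w :: "'e \<times> 'f"
  obtain a b where w: "w = (a, b)" by (cases w)
  note simps = base.left_simps[OF assms(1)] fibre.left_simps[OF assms(2)]
  have A: "2 * A x (christoffel A x u v) a = base.koszul x u v a"
    by (rule base.christoffel_koszul[OF assms(1)])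
  have B: "2 * B y (christoffel B y u' v') b = fibre.koszul y u' v' b"
    by (rule fibre.christoffel_koszul[OF assms(2)])
  \<comment> \<open>The cross terms come from differentiating the squared warping function. The
    first two become the vertical corrections, and the last, dualised by the base metric, becomes
    the \<open>grad\<close> term.\<close>
  have K: "prod.koszul (x, y) (u, u') (v, v') w = base.koszul x u v a + (\<phi> x)\<^sup>2 * fibre.koszul y u' v' b
      + 2 * \<phi> x * (dderiv \<phi> x u * B y v' b + dderiv \<phi> x v * B y u' b - dderiv \<phi> x a * B y u' v')"
    unfolding prod.koszul_def base.koszul_def fibre.koszul_def w
    by (simp add: dderiv_wprod assms algebra_simps)
  then show "2 * W (x, y) (christoffel A x u v - (\<phi> x * B y u' v') *\<^sub>R grad x,
     christoffel B y u' v' + (dderiv \<phi> x u / \<phi> x) *\<^sub>R v' + (dderiv \<phi> x v / \<phi> x) *\<^sub>R u') w =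
     prod.koszul (x, y) (u, u') (v, v') w"
    using warp_pos[OF assms(1)]
    unfolding K A[symmetric] B[symmetric]
    by (simp add: w wprod_def simps grad assms(1) field_simps power2_eq_square)
qed

text \<open>Geometrically, the base leaves are totally geodesic, and the horizontal part in the last
  formula is the second fundamental form of the fibres.\<close>

lemma christoffel_wprod_blocks:
  assumes "x \<in> U" "y \<in> V"
  shows "christoffel W (x, y) (u, 0) (v, 0) = (christoffel A x u v, 0)"
    and "christoffel W (x, y) (u, 0) (0, v') = (0, (dderiv \<phi> x u / \<phi> x) *\<^sub>R v')"
    and "christoffel W (x, y) (0, u') (v, 0) = (0, (dderiv \<phi> x v / \<phi> x) *\<^sub>R u')"
    and "christoffel W (x, y) (0, u') (0, v') =
      (- ((\<phi> x * B y u' v') *\<^sub>R grad x), christoffel B y u' v')"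
  using linear_0[OF dwarp_linear[OF assms(1)]]
  by (simp_all add: christoffel_wprod assms base.christoffel_zero fibre.christoffel_zero
      fibre.left_simps fibre.right_simps)

lemma christoffel_wprod_split:
  assumes "x \<in> U" "y \<in> V"
  shows "christoffel W (x, y) u (a, b) = christoffel W (x, y) u (a, 0) + christoffel W (x, y) u (0, b)"
  using linear_add[OF prod.christoffel_linear, of "(x, y)" u "(a, 0)" "(0, b)"] assms by simp

lemma fst_dderiv_christoffel:
  assumes "x \<in> U" "y \<in> V" "\<And>x y. x \<in> U \<Longrightarrow> y \<in> V \<Longrightarrow> fst (christoffel W (x, y) v w) = F (x, y)"
  shows "fst (dderiv (\<lambda>z. christoffel W z v w) (x, y) u) = dderiv F (x, y) u"
proof -
  have z: "(x, y) \<in> U \<times> V" using assms by simp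
  have "dderiv (\<lambda>z. fst (christoffel W z v w)) (x, y) u = dderiv F (x, y) u"
    by (rule dderiv_cong[OF open_prod z]) (use assms(3) in auto)
  then show ?thesis
    by (simp add: fst_dderiv smooth_on_differentiable[OF prod.christoffel_smooth z])
qed

lemma snd_dderiv_christoffel:
  assumes "x \<in> U" "y \<in> V" "\<And>x y. x \<in> U \<Longrightarrow> y \<in> V \<Longrightarrow> snd (christoffel W (x, y) v w) = F (x, y)"
  shows "snd (dderiv (\<lambda>z. christoffel W z v w) (x, y) u) = dderiv F (x, y) u"
proof -
  have z: "(x, y) \<in> U \<times> V" using assms by simp
  have "dderiv (\<lambda>z. snd (christoffel W z v w)) (x, y) u = dderiv F (x, y) u"
    by (rule dderiv_cong[OF open_prod z]) (use assms(3) in auto)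
  then show ?thesis
    by (simp add: snd_dderiv smooth_on_differentiable[OF prod.christoffel_smooth z])
qed

section \<open>Curvature components and the Ricci tensor of a warped product\<close>

lemma curvature_base:
  assumes "x \<in> U" "y \<in> V"
  shows "fst (curvature W (x, y) (u, 0) (v, 0) (w, 0)) = curvature A x u v w"
proof -
  have "fst (dderiv (\<lambda>z. christoffel W z (v, 0) (w, 0)) (x, y) (u, 0)) =
      dderiv (\<lambda>x. christoffel A x v w) x u" for u v
    using fst_dderiv_christoffel[OF assms, of "(v, 0)" "(w, 0)" "\<lambda>z. christoffel A (fst z) v w" "(u, 0)"]
      dderiv_compose_fst[OF smooth_on_differentiable[OF base.christoffel_smooth], of "(x, y)"] assms
    by (simp add: christoffel_wprod_blocks)
  then show ?thesis
    by (simp add: curvature_def christoffel_wprod_blocks assms)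
qed

lemma curvature_mixed:
  assumes "x \<in> U" "y \<in> V"
  shows "snd (curvature W (x, y) (0, u) (v, 0) (w, 0)) = (- (hessian A \<phi> x v w / \<phi> x)) *\<^sub>R u"
proof -
  let ?q = "\<lambda>x. dderiv \<phi> x w * inverse (\<phi> x)"
  have D1: "snd (dderiv (\<lambda>z. christoffel W z (v, 0) (w, 0)) (x, y) (0, u)) = 0"
    using snd_dderiv_christoffel[OF assms, of "(v, 0)" "(w, 0)" "\<lambda>z. 0" "(0, u)"]
      dderiv_eqI[OF has_derivative_const]
    by (simp add: christoffel_wprod_blocks)
  have "(?q has_derivative (\<lambda>a. dderiv \<phi> x w * (- (inverse (\<phi> x) * dderiv \<phi> x a * inverse (\<phi> x)))
      + dderiv (\<lambda>y. dderiv \<phi> y w) x a * inverse (\<phi> x))) (at x)"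
    using warp_pos[OF assms(1)]
    by (intro has_derivative_mult Deriv.has_derivative_inverse
        smooth_on_has_derivative[OF _ assms(1)] warp_smooth smooth_on_dderiv) simp
  then have "((\<lambda>z. ?q (fst z) *\<^sub>R u) has_derivative
      (\<lambda>a. (dderiv \<phi> x w * (- (inverse (\<phi> x) * dderiv \<phi> x (fst a) * inverse (\<phi> x)))
      + dderiv (\<lambda>y. dderiv \<phi> y w) x (fst a) * inverse (\<phi> x)) *\<^sub>R u)) (at (x, y))"
    by (intro has_derivative_scaleR_left has_derivative_compose_fst) simp
  from dderiv_eqI[OF this, of "(v, 0)"]
  have D2: "snd (dderiv (\<lambda>z. christoffel W z (0, u) (w, 0)) (x, y) (v, 0)) =
      (dderiv \<phi> x w * (- (inverse (\<phi> x) * dderiv \<phi> x v * inverse (\<phi> x)))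
      + dderiv (\<lambda>y. dderiv \<phi> y w) x v * inverse (\<phi> x)) *\<^sub>R u"
    using snd_dderiv_christoffel[OF assms, of "(0, u)" "(w, 0)" "\<lambda>z. ?q (fst z) *\<^sub>R u" "(v, 0)"]
    by (simp add: christoffel_wprod_blocks divide_inverse)
  have "snd (curvature W (x, y) (0, u) (v, 0) (w, 0)) =
      (dderiv \<phi> x (christoffel A x v w) / \<phi> x
        - (dderiv \<phi> x w * (- (inverse (\<phi> x) * dderiv \<phi> x v * inverse (\<phi> x)))
          + dderiv (\<lambda>y. dderiv \<phi> y w) x v * inverse (\<phi> x))
        - dderiv \<phi> x v / \<phi> x * (dderiv \<phi> x w / \<phi> x)) *\<^sub>R u"
    unfolding curvature_def
    by (simp add: D1 D2 christoffel_wprod_blocks assms scaleR_diff_left)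
  \<comment> \<open>The quadratic terms in the first derivatives of \<open>\<phi>\<close>, one from
    the quotient rule and one from the iterated Christoffel symbols, cancel.\<close>
  also have "\<dots> = (- (hessian A \<phi> x v w / \<phi> x)) *\<^sub>R u"
    by (simp add: hessian_def divide_inverse algebra_simps)
  finally show ?thesis .
qed

text \<open>The basis of the product is the disjoint union of the two factor bases, and the trace
  sees only diagonal blocks. Hence the curvature lemmas compute just one component each.\<close>

lemma ricci_wprod: "ricci W z v w =
    (\<Sum>b\<in>Basis. fst (curvature W z (b, 0) v w) \<bullet> b) + (\<Sum>b\<in>Basis. snd (curvature W z (0, b) v w) \<bullet> b)"
proof -
  have "inj_on (\<lambda>b. (b::'e, 0::'f)) Basis" "inj_on (\<lambda>b. (0::'e, b::'f)) Basis"
    by (auto simp: inj_on_def)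
  then show ?thesis
    unfolding ricci_def trace_op_def Basis_prod_def
    by (subst sum.union_disjoint) (auto simp: Basis_prod_def sum.reindex inner_prod_def)
qed

text \<open>The mixed block is a multiple of the identity on the fibre, whose trace contributes
  \<open>DIM('f)\<close>.\<close>

lemma ricci_wprod_horizontal:
  assumes "x \<in> U" "y \<in> V"
  shows "ricci W (x, y) (v, 0) (w, 0) = ricci A x v w - DIM('f) / \<phi> x * hessian A \<phi> x v w"
  unfolding ricci_wprod curvature_base[OF assms] curvature_mixed[OF assms]
  by (simp add: ricci_def trace_op_def)

text \<open>A Gauss equation for the fibre: differentiating vertical fields leaves a multiple of
  \<open>grad x\<close>, and its derivative along a vertical vector returns a multiple of that
  vector.\<close>

lemma curvature_fibre:
  assumes "x \<in> U" "y \<in> V"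
  shows "snd (curvature W (x, y) (0, u) (0, v) (0, w)) =
    curvature B y u v w - dderiv \<phi> x (grad x) *\<^sub>R (B y v w *\<^sub>R u - B y u w *\<^sub>R v)"
proof -
  have D: "snd (dderiv (\<lambda>z. christoffel W z (0, v) (0, w)) (x, y) (0, u)) =
      dderiv (\<lambda>x. christoffel B x v w) y u" for u v
    using snd_dderiv_christoffel[OF assms, of "(0, v)" "(0, w)" "\<lambda>z. christoffel B (snd z) v w" "(0, u)"]
      dderiv_compose_snd[OF smooth_on_differentiable[OF fibre.christoffel_smooth], of "(x, y)"] assms
    by (simp add: christoffel_wprod_blocks)
  have S: "snd (christoffel W (x, y) (0, u) (- ((\<phi> x * c) *\<^sub>R grad x), a)) =
      christoffel B y u a - (c * dderiv \<phi> x (grad x)) *\<^sub>R u" for u c a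
    using warp_pos[OF assms(1)]
      christoffel_wprod_split[OF assms, of "(0, u)" "- ((\<phi> x * c) *\<^sub>R grad x)" a]
    by (simp add: christoffel_wprod_blocks assms
       linear_neg[OF dwarp_linear[OF assms(1)]] linear_scale[OF dwarp_linear[OF assms(1)]])
  show ?thesis
    unfolding curvature_def
    by (simp add: D S christoffel_wprod_blocks assms algebra_simps)
qed

text \<open>The bracket is \<open>\<phi>\<close> times the covariant derivative of the gradient
  along \<open>u\<close>. What counts is that it involves base data only, so \<open>B y v w\<close>
  factors out of the trace.\<close>

lemma curvature_fibre_mixed:
  assumes "x \<in> U" "y \<in> V"
  shows "fst (curvature W (x, y) (u, 0) (0, v) (0, w)) =
    - (B y v w *\<^sub>R (dderiv (\<lambda>x. \<phi> x *\<^sub>R grad x) x u + \<phi> x *\<^sub>R christoffel A x u (grad x)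
       - dderiv \<phi> x u *\<^sub>R grad x))"
proof -
  let ?N = "\<lambda>x. \<phi> x *\<^sub>R grad x"
  have "?N differentiable (at x)"
    using smooth_on_differentiable[OF warp_smooth assms(1)] smooth_on_differentiable[OF grad_smooth assms(1)]
    by (intro differentiable_scaleR)
  then have "((\<lambda>z. ?N (fst z)) has_derivative (\<lambda>a. dderiv ?N x (fst a))) (at (x, y))"
    using has_derivative_compose_fst[of ?N _ "(x, y)"] dderiv_works[of ?N x] by simp
  moreover have "((\<lambda>z. B (snd z) v w) has_derivative (\<lambda>a. dderiv (\<lambda>y. B y v w) y (snd a))) (at (x, y))"
    using smooth_on_has_derivative[OF fibre.smooth assms(2)] by (intro has_derivative_compose_snd) simp
  ultimately have "((\<lambda>z. - (B (snd z) v w *\<^sub>R ?N (fst z))) has_derivative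
      (\<lambda>a. - (B (snd (x, y)) v w *\<^sub>R dderiv ?N x (fst a)
        + dderiv (\<lambda>y. B y v w) y (snd a) *\<^sub>R ?N (fst (x, y))))) (at (x, y))"
    by (intro has_derivative_minus has_derivative_scaleR)
  from dderiv_eqI[OF this, of "(u, 0)"]
  have D1: "fst (dderiv (\<lambda>z. christoffel W z (0, v) (0, w)) (x, y) (u, 0)) =
      - (B y v w *\<^sub>R dderiv ?N x u)"
    using fst_dderiv_christoffel[OF assms, of "(0, v)" "(0, w)" "\<lambda>z. - (B (snd z) v w *\<^sub>R ?N (fst z))" "(u, 0)"]
      linear_0[OF fibre.dderiv_metric_linear_dir[OF assms(2)], of v w]
    by (simp add: christoffel_wprod_blocks mult.commute)
  have D2: "fst (dderiv (\<lambda>z. christoffel W z (u, 0) (0, w)) (x, y) (0, v)) = 0"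
    using fst_dderiv_christoffel[OF assms, of "(u, 0)" "(0, w)" "\<lambda>z. 0" "(0, v)"]
      dderiv_eqI[OF has_derivative_const]
    by (simp add: christoffel_wprod_blocks)
  have S: "fst (christoffel W (x, y) (u, 0) (- ((\<phi> x * c) *\<^sub>R grad x), a)) =
      - ((\<phi> x * c) *\<^sub>R christoffel A x u (grad x))" for c a
    using christoffel_wprod_split[OF assms, of "(u, 0)" "- ((\<phi> x * c) *\<^sub>R grad x)" a]
    by (simp add: christoffel_wprod_blocks assms
       linear_neg[OF base.christoffel_linear[OF assms(1)]] linear_scale[OF base.christoffel_linear[OF assms(1)]])
  show ?thesis
    unfolding curvature_def using warp_pos[OF assms(1)]
    by (simp add: D1 D2 S christoffel_wprod_blocks assms fibre.right_simps algebra_simps)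
qed

text \<open>In invariant terms: \<open>\<phi>\<close> times its Laplacian on the base, plus
  \<open>DIM('f) - 1\<close> times the squared length of its gradient.\<close>

definition fibre_factor :: "'e \<Rightarrow> real" where
  "fibre_factor x = (\<Sum>b\<in>Basis. (dderiv (\<lambda>x. \<phi> x *\<^sub>R grad x) x b
      + \<phi> x *\<^sub>R christoffel A x b (grad x) - dderiv \<phi> x b *\<^sub>R grad x) \<bullet> b)
    + (real DIM('f) - 1) * dderiv \<phi> x (grad x)"

lemma ricci_wprod_vertical:
  assumes "x \<in> U" "y \<in> V"
  shows "ricci W (x, y) (0, v) (0, w) = ricci B y v w - fibre_factor x * B y v w"
proof -
  \<comment> \<open>This is the trace of the rank-one map sending \<open>u\<close> to
    \<open>B y u w *\<^sub>R v\<close>; it is subtracted once from the \<open>DIM('f)\<close> copies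
    given by the identity.\<close>
  have "(\<Sum>b\<in>Basis. B y b w * (v \<bullet> b)) = B y v w"
    using fibre.left_Basis_sum[OF assms(2), of v w] by (simp add: mult.commute)
  then have V: "(\<Sum>b\<in>Basis. snd (curvature W (x, y) (0, b) (0, v) (0, w)) \<bullet> b) =
      ricci B y v w - dderiv \<phi> x (grad x) * (DIM('f) * B y v w - B y v w)"
    unfolding curvature_fibre[OF assms]
    by (simp add: ricci_def trace_op_def inner_diff_left sum_subtractf flip: sum_distrib_left)
  define s where "s = (\<Sum>b\<in>Basis. (dderiv (\<lambda>x. \<phi> x *\<^sub>R grad x) x b
      + \<phi> x *\<^sub>R christoffel A x b (grad x) - dderiv \<phi> x b *\<^sub>R grad x) \<bullet> b)"
  have H: "(\<Sum>b\<in>Basis. fst (curvature W (x, y) (b, 0) (0, v) (0, w)) \<bullet> b) = - (B y v w * s)"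
    unfolding curvature_fibre_mixed[OF assms] inner_minus_left inner_scaleR_left sum_negf s_def
      sum_distrib_left ..
  show ?thesis
    unfolding ricci_wprod V H fibre_factor_def s_def[symmetric]
    by (simp add: algebra_simps)
qed

text \<open>The covariant derivative of horizontal constant fields is the one on the base, with no
  vertical part, so both terms of the Hessian reduce to the base.\<close>

lemma hessian_wprod_horizontal:
  assumes "x \<in> U" "y \<in> V" "smooth_on U F"
  shows "hessian W (\<lambda>z. F (fst z)) (x, y) (u, 0) (v, 0) = hessian A F x u v"
proof -
  have d: "dderiv (\<lambda>z. F (fst z)) z a = dderiv F (fst z) (fst a)" if "z \<in> U \<times> V" for z :: "'e \<times> 'f" and a
    using that smooth_on_differentiable[OF assms(3)] by (intro dderiv_compose_fst) auto
  have "dderiv (\<lambda>z. dderiv (\<lambda>z. F (fst z)) z (v, 0::'f)) (x, y) (u, 0) =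
      dderiv (\<lambda>z. dderiv F (fst z) v) (x, y) (u, 0)"
    using assms(1,2) d by (intro dderiv_cong[OF open_prod]) auto
  also have "\<dots> = dderiv (\<lambda>x. dderiv F x v) x u"
    using dderiv_compose_fst[OF smooth_on_differentiable[OF smooth_on_dderiv[OF assms(3)]], of "(x, y)" v]
      assms(1) by simp
  finally show ?thesis
    unfolding hessian_def using assms(1,2) d[of "(x, y)"] by (simp add: christoffel_wprod_blocks)
qed

end

lemma coord_metric_cong:
  assumes "coord_metric U G" "\<And>x. x \<in> U \<Longrightarrow> G x = G' x"
  shows "coord_metric U G'"
proof -
  interpret coord_metric U G by fact
  show ?thesis
  proof
    show "smooth_on U (\<lambda>x. G' x u v)" for u v
      by (rule smooth_on_cong[OF open_dom _ smooth]) (simp add: assms(2))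
  qed (use open_dom bilin sym nondeg in \<open>simp_all flip: assms(2)\<close>)
qed

section \<open>Warped products of manifolds\<close>

text \<open>The chartwise content of \<open>semi_riemannian\<close>, which the intermediate product
  of \<open>M1\<close> and \<open>M2\<close> inherits directly from its factors.\<close>

definition chart_metric :: "('i, 'a, 'e::euclidean_space) mfd \<Rightarrow> ('i, 'a, 'e) tensor2 \<Rightarrow> bool" where
  "chart_metric M g \<longleftrightarrow> (\<forall>i\<in>midx M. mdom M i \<subseteq> mcar M \<and> inj_on (mcoord M i) (mdom M i) \<and>
     coord_metric (mimg M i) (local_metric M g i))"

lemma mparam_in_mdom: "x \<in> mimg M i \<Longrightarrow> mparam M i x \<in> mdom M i"
  by (simp add: mimg_def mparam_def inv_into_into)

lemma mcoord_mparam: "x \<in> mimg M i \<Longrightarrow> mcoord M i (mparam M i x) = x"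
  by (simp add: mimg_def mparam_def f_inv_into_f)

lemma mcoord_in_mimg: "p \<in> mdom M i \<Longrightarrow> mcoord M i p \<in> mimg M i"
  by (simp add: mimg_def)

lemma mparam_mcoord:
  "chart_metric M g \<Longrightarrow> i \<in> midx M \<Longrightarrow> p \<in> mdom M i \<Longrightarrow> mparam M i (mcoord M i p) = p"
  by (simp add: chart_metric_def mparam_def inv_into_f_f)

lemma chart_metric_bilinear:
  assumes "chart_metric M g" "i \<in> midx M" "p \<in> mdom M i"
  shows "bilinear (g i p)"
proof -
  interpret coord_metric "mimg M i" "local_metric M g i"
    using assms by (simp add: chart_metric_def)
  show ?thesis
    using bilin[OF mcoord_in_mimg[OF assms(3)]] mparam_mcoord[OF assms]
    by (simp add: local_metric_def)
qed

lemma semi_riemannian_chart_metric: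
  assumes "semi_riemannian M g"
  shows "chart_metric M g"
  unfolding chart_metric_def
proof (intro ballI conjI)
  fix i assume i: "i \<in> midx M"
  have M: "smooth_manifold M" and g: "smooth_tensor2 M g"
    using assms by (auto simp: semi_riemannian_def)
  have op: "openin (mtop M) (mdom M i)" and opi: "open (mimg M i)"
    and homeo: "homeomorphic_map (subtopology (mtop M) (mdom M i)) (top_of_set (mimg M i)) (mcoord M i)"
    using M i by (auto simp: smooth_manifold_def)
  show sub: "mdom M i \<subseteq> mcar M"
    using openin_subset[OF op] .
  show "inj_on (mcoord M i) (mdom M i)"
    using homeomorphic_imp_injective_map[OF homeo] sub by (simp add: Int_absorb1)
  show "coord_metric (mimg M i) (local_metric M g i)"
  proof
    show "smooth_on (mimg M i) (\<lambda>x. local_metric M g i x u v)" for u v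
      using g i by (simp add: smooth_tensor2_def local_metric_def o_def)
    fix x assume "x \<in> mimg M i"
    note p = mparam_in_mdom[OF this]
    show "bilinear (local_metric M g i x)"
      using g i p by (simp add: smooth_tensor2_def local_metric_def)
    show "local_metric M g i x u v = local_metric M g i x v u" for u v
      using assms i p by (simp add: semi_riemannian_def local_metric_def)
    show "u = 0" if "\<And>v. local_metric M g i x u v = 0" for u
      using assms i p that by (simp add: semi_riemannian_def local_metric_def)
  qed (rule opi)
qed

lemma midx_prod [simp]: "midx (M \<times>\<^sub>M\<^sub>f N) = midx M \<times> midx N"
  and mdom_prod [simp]: "mdom (M \<times>\<^sub>M\<^sub>f N) (i, j) = mdom M i \<times> mdom N j"
  and mcoord_prod [simp]: "mcoord (M \<times>\<^sub>M\<^sub>f N) (i, j) (p, q) = (mcoord M i p, mcoord N j q)"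
  and mcar_prod [simp]: "mcar (M \<times>\<^sub>M\<^sub>f N) = mcar M \<times> mcar N"
  by (simp_all add: prod_mfd_def)

lemma mimg_prod [simp]: "mimg (M \<times>\<^sub>M\<^sub>f N) (i, j) = mimg M i \<times> mimg N j"
  by (force simp: mimg_def)

lemma inj_on_mcoord_prod:
  assumes "inj_on (mcoord M i) (mdom M i)" "inj_on (mcoord N j) (mdom N j)"
  shows "inj_on (mcoord (M \<times>\<^sub>M\<^sub>f N) (i, j)) (mdom (M \<times>\<^sub>M\<^sub>f N) (i, j))"
  using assms by (auto simp: inj_on_def)

text \<open>Injectivity determines \<open>inv_into\<close> on the chart image, so there the product
  chart is inverted componentwise.\<close>

lemma mparam_prod:
  assumes "inj_on (mcoord M i) (mdom M i)" "inj_on (mcoord N j) (mdom N j)"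
    and "x \<in> mimg M i" "y \<in> mimg N j"
  shows "mparam (M \<times>\<^sub>M\<^sub>f N) (i, j) (x, y) = (mparam M i x, mparam N j y)"
  unfolding mparam_def[of "M \<times>\<^sub>M\<^sub>f N"]
  using inj_on_mcoord_prod[OF assms(1,2)] assms(3,4)
  by (intro inv_into_f_eq) (simp_all add: mparam_in_mdom mcoord_mparam)

lemma local_metric_warped:
  assumes "inj_on (mcoord M i) (mdom M i)" "inj_on (mcoord N j) (mdom N j)"
    and "z \<in> mimg M i \<times> mimg N j"
  shows "local_metric (M \<times>\<^sub>M\<^sub>f N) (warped_metric g \<phi> g') (i, j) z =
    wprod (local_metric M g i) (\<phi> \<circ> mparam M i) (local_metric N g' j) z"
  using assms mparam_prod[OF assms(1,2), of "fst z" "snd z"]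
  by (auto simp: fun_eq_iff local_metric_def warped_metric_def wprod_def)

lemma warped_coord_charts:
  assumes "chart_metric M g" "chart_metric N g'" "warping_function M \<phi>" "i \<in> midx M" "j \<in> midx N"
  shows "warped_coord (mimg M i) (local_metric M g i) (mimg N j) (local_metric N g' j) (\<phi> \<circ> mparam M i)"
proof (intro warped_coord.intro warped_coord_axioms.intro)
  show "smooth_on (mimg M i) (\<phi> \<circ> mparam M i)"
    using assms by (simp add: warping_function_def smooth_fun_def)
  show "(\<phi> \<circ> mparam M i) x > 0" if "x \<in> mimg M i" for x
    using assms mparam_in_mdom[OF that]
    unfolding warping_function_def chart_metric_def comp_def by blast
qed (use assms in \<open>simp_all add: chart_metric_def\<close>)

lemma chart_metric_warped:
  assumes "chart_metric M g" "chart_metric N g'" "warping_function M \<phi>"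
  shows "chart_metric (M \<times>\<^sub>M\<^sub>f N) (warped_metric g \<phi> g')"
  unfolding chart_metric_def
proof (intro ballI)
  fix k assume "k \<in> midx (M \<times>\<^sub>M\<^sub>f N)"
  then obtain i j where k: "k = (i, j)" and i: "i \<in> midx M" and j: "j \<in> midx N" by auto
  interpret warped_coord "mimg M i" "local_metric M g i" "mimg N j" "local_metric N g' j" "\<phi> \<circ> mparam M i"
    using warped_coord_charts[OF assms i j] .
  have inj: "inj_on (mcoord M i) (mdom M i)" "inj_on (mcoord N j) (mdom N j)"
    using assms i j by (auto simp: chart_metric_def)
  have "coord_metric (mimg M i \<times> mimg N j) (local_metric (M \<times>\<^sub>M\<^sub>f N) (warped_metric g \<phi> g') (i, j))"
    by (rule coord_metric_cong[OF prod.coord_metric_axioms]) (simp add: local_metric_warped[OF inj])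
  moreover have "mdom M i \<times> mdom N j \<subseteq> mcar M \<times> mcar N"
    using assms i j by (auto simp: chart_metric_def)
  ultimately show "mdom (M \<times>\<^sub>M\<^sub>f N) k \<subseteq> mcar (M \<times>\<^sub>M\<^sub>f N) \<and>
      inj_on (mcoord (M \<times>\<^sub>M\<^sub>f N) k) (mdom (M \<times>\<^sub>M\<^sub>f N) k) \<and>
      coord_metric (mimg (M \<times>\<^sub>M\<^sub>f N) k) (local_metric (M \<times>\<^sub>M\<^sub>f N) (warped_metric g \<phi> g') k)"
    using inj_on_mcoord_prod[OF inj] by (simp add: k)
qed

lemma Ric_warped:
  fixes M :: "('i, 'a, 'e::euclidean_space) mfd" and N :: "('j, 'b, 'f::euclidean_space) mfd"
  assumes "chart_metric M g" "chart_metric N g'" "warping_function M \<phi>"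
    and "i \<in> midx M" "p \<in> mdom M i"
  shows Ric_warped_horizontal: "\<And>j q v w. j \<in> midx N \<Longrightarrow> q \<in> mdom N j \<Longrightarrow>
      Ric (M \<times>\<^sub>M\<^sub>f N) (warped_metric g \<phi> g') (i, j) (p, q) (v, 0) (w, 0) =
      Ric M g i p v w - DIM('f) / \<phi> p * Hess M g \<phi> i p v w"
    and Ric_warped_vertical: "\<exists>c. \<forall>j\<in>midx N. \<forall>q\<in>mdom N j. \<forall>v w.
      Ric (M \<times>\<^sub>M\<^sub>f N) (warped_metric g \<phi> g') (i, j) (p, q) (0, v) (0, w) =
      Ric N g' j q v w - c * g' j q v w"
proof -
  let ?G = "local_metric (M \<times>\<^sub>M\<^sub>f N) (warped_metric g \<phi> g')"
  have coord: "mcoord M i p \<in> mimg M i"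
    using assms(5) by (rule mcoord_in_mimg)
  have inj: "inj_on (mcoord M i) (mdom M i)" "j \<in> midx N \<Longrightarrow> inj_on (mcoord N j) (mdom N j)" for j
    using assms by (auto simp: chart_metric_def)
  have cong: "ricci (?G (i, j)) (mcoord M i p, mcoord N j q) v w =
      ricci (wprod (local_metric M g i) (\<phi> \<circ> mparam M i) (local_metric N g' j))
        (mcoord M i p, mcoord N j q) v w"
    if j: "j \<in> midx N" and q: "q \<in> mdom N j" for j q v w
  proof -
    interpret warped_coord "mimg M i" "local_metric M g i" "mimg N j" "local_metric N g' j" "\<phi> \<circ> mparam M i"
      using warped_coord_charts[OF assms(1-4) j] .
    show ?thesis
      by (rule ricci_cong[OF open_prod])
        (use coord mcoord_in_mimg[OF q] local_metric_warped[OF inj(1) inj(2)[OF j]] in auto)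
  qed
  show "Ric (M \<times>\<^sub>M\<^sub>f N) (warped_metric g \<phi> g') (i, j) (p, q) (v, 0) (w, 0) =
      Ric M g i p v w - DIM('f) / \<phi> p * Hess M g \<phi> i p v w"
    if j: "j \<in> midx N" and q: "q \<in> mdom N j" for j q v w
  proof -
    interpret warped_coord "mimg M i" "local_metric M g i" "mimg N j" "local_metric N g' j" "\<phi> \<circ> mparam M i"
      using warped_coord_charts[OF assms(1-4) j] .
    show ?thesis
      using ricci_wprod_horizontal[OF coord mcoord_in_mimg[OF q]]
        mparam_mcoord[OF assms(1,4,5)]
      by (simp add: Ric_def Hess_def cong[OF j q])
  qed
  show "\<exists>c. \<forall>j\<in>midx N. \<forall>q\<in>mdom N j. \<forall>v w.
      Ric (M \<times>\<^sub>M\<^sub>f N) (warped_metric g \<phi> g') (i, j) (p, q) (0, v) (0, w) =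
      Ric N g' j q v w - c * g' j q v w"
  proof -
    \<comment> \<open>The witness uses the base chart and the fibre dimension only, so one
      \<open>c\<close> serves all fibre charts and points. It is therefore named outside any
      interpretation, with the fibre type passed as \<open>TYPE('f)\<close>.\<close>
    let ?c = "warped_coord.fibre_factor TYPE('f) (local_metric M g i) (\<phi> \<circ> mparam M i) (mcoord M i p)"
    show ?thesis
    proof (intro exI[of _ ?c] ballI allI)
      fix j q v w assume j: "j \<in> midx N" and q: "q \<in> mdom N j"
      interpret warped_coord "mimg M i" "local_metric M g i" "mimg N j" "local_metric N g' j" "\<phi> \<circ> mparam M i"
        using warped_coord_charts[OF assms(1-4) j] .
      show "Ric (M \<times>\<^sub>M\<^sub>f N) (warped_metric g \<phi> g') (i, j) (p, q) (0, v) (0, w) =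
          Ric N g' j q v w - ?c * g' j q v w"
        using ricci_wprod_vertical[OF coord mcoord_in_mimg[OF q]]
          mparam_mcoord[OF assms(2) j q]
        by (simp add: Ric_def local_metric_def[of N] cong[OF j q])
    qed
  qed
qed

lemma Hess_warped_horizontal:
  assumes "chart_metric M g" "chart_metric N g'" "warping_function M \<phi>" "smooth_fun M F"
    and "i \<in> midx M" "p \<in> mdom M i" "j \<in> midx N" "q \<in> mdom N j"
  shows "Hess (M \<times>\<^sub>M\<^sub>f N) (warped_metric g \<phi> g') (\<lambda>z. F (fst z)) (i, j) (p, q) (u, 0) (v, 0) =
    Hess M g F i p u v"
proof -
  interpret warped_coord "mimg M i" "local_metric M g i" "mimg N j" "local_metric N g' j" "\<phi> \<circ> mparam M i"
    using warped_coord_charts[OF assms(1-3,5,7)] .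
  have inj: "inj_on (mcoord M i) (mdom M i)" "inj_on (mcoord N j) (mdom N j)"
    using assms by (auto simp: chart_metric_def)
  have coords: "mcoord M i p \<in> mimg M i" "mcoord N j q \<in> mimg N j"
    using assms by (simp_all add: mcoord_in_mimg)
  have "hessian (local_metric (M \<times>\<^sub>M\<^sub>f N) (warped_metric g \<phi> g') (i, j))
      ((\<lambda>z. F (fst z)) \<circ> mparam (M \<times>\<^sub>M\<^sub>f N) (i, j)) (mcoord M i p, mcoord N j q) (u, 0) (v, 0) =
    hessian W (\<lambda>z. (F \<circ> mparam M i) (fst z)) (mcoord M i p, mcoord N j q) (u, 0) (v, 0)"
    by (rule hessian_cong[OF open_prod])
      (use coords local_metric_warped[OF inj] mparam_prod[OF inj] in auto)
  also have "\<dots> = hessian (local_metric M g i) (F \<circ> mparam M i) (mcoord M i p) u v"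
    using assms by (intro hessian_wprod_horizontal coords) (simp add: smooth_fun_def o_def)
  finally show ?thesis by (simp add: Hess_def)
qed

text \<open>Prepares the second lift of \<open>f\<close>: its lift to the product of
  \<open>M1\<close> and \<open>M2\<close> must be smooth before the Hessian comparison applies to
  the outer product.\<close>

lemma smooth_fun_compose_fst:
  assumes "chart_metric M g" "chart_metric N g'" "smooth_fun M F"
  shows "smooth_fun (M \<times>\<^sub>M\<^sub>f N) (\<lambda>z. F (fst z))"
  unfolding smooth_fun_def
proof
  fix k assume "k \<in> midx (M \<times>\<^sub>M\<^sub>f N)"
  then obtain i j where k: "k = (i, j)" and i: "i \<in> midx M" and j: "j \<in> midx N" by auto
  have inj: "inj_on (mcoord M i) (mdom M i)" "inj_on (mcoord N j) (mdom N j)"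
    and op: "open (mimg M i \<times> mimg N j)"
    using assms i j by (auto simp: chart_metric_def coord_metric_def open_Times)
  have "Ck_on m (mimg M i) (\<lambda>x. F (mparam M i x))" for m
    using assms(3) i by (simp add: smooth_fun_def smooth_on_def o_def)
  then have "smooth_on (mimg M i \<times> mimg N j) (\<lambda>z. F (mparam M i (fst z)))"
    unfolding smooth_on_def by (intro allI Ck_on_compose_fst[OF op, where U="mimg M i"]) auto
  then show "smooth_on (mimg (M \<times>\<^sub>M\<^sub>f N) k) ((\<lambda>z. F (fst z)) \<circ> mparam (M \<times>\<^sub>M\<^sub>f N) k)"
    unfolding k mimg_prod by (rule smooth_on_cong[OF op, rotated]) (auto simp: mparam_prod[OF inj])
qed

section \<open>Einstein factors of a conformal soliton\<close>

text \<open>The factor may be an arbitrary function, such as one built from \<open>scal\<close> or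
  from values over a fixed point; its smoothness is recovered from the tensors in each
  chart.\<close>

lemma einstein_manifoldI:
  assumes g: "semi_riemannian M g"
    and Ric: "\<And>i p u v. i \<in> midx M \<Longrightarrow> p \<in> mdom M i \<Longrightarrow> Ric M g i p u v = \<mu> p * g i p u v"
  shows "einstein_manifold M g"
proof -
  note cm = semi_riemannian_chart_metric[OF g]
  have "smooth_on (mimg M i) (\<mu> \<circ> mparam M i)" if i: "i \<in> midx M" for i
  proof -
    interpret coord_metric "mimg M i" "local_metric M g i"
      using cm i by (simp add: chart_metric_def)
    show ?thesis
      by (rule einstein_factor_smooth)
        (use Ric[OF i mparam_in_mdom] in \<open>simp add: Ric_def local_metric_def mcoord_mparam\<close>)
  qed
  then show ?thesis
    using g Ric by (auto simp: einstein_manifold_def smooth_fun_def tensor_eq_def fscale_def)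
qed

lemma conformal_soliton_Ric:
  assumes "ricci_bourguignon_soliton M g X lam \<rho>" "conformal_vfield M g X"
  obtains \<mu> where "\<And>i p u v. i \<in> midx M \<Longrightarrow> p \<in> mdom M i \<Longrightarrow> Ric M g i p u v = \<mu> p * g i p u v"
proof -
  obtain \<alpha> where \<alpha>: "tensor_eq M (Lie M X g) (fscale (\<lambda>p. 2 * \<alpha> p) g)"
    using assms(2) by (auto simp: conformal_vfield_def)
  have "Ric M g i p u v = (lam + \<rho> * scal M g p - \<alpha> p) * g i p u v"
    if "i \<in> midx M" "p \<in> mdom M i" for i p u v
  proof -
    have "Ric M g i p u v + 1/2 * Lie M X g i p u v = lam * g i p u v + \<rho> * scal M g p * g i p u v"
      using assms(1) that by (simp add: ricci_bourguignon_soliton_def tensor_eq_def)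
    moreover have "Lie M X g i p u v = 2 * \<alpha> p * g i p u v"
      using \<alpha> that by (simp add: tensor_eq_def fscale_def)
    ultimately show ?thesis by (simp add: algebra_simps)
  qed
  then show thesis by (rule that)
qed

lemma semi_riemannian_chart_at:
  assumes "semi_riemannian M g"
  obtains i p where "i \<in> midx M" "p \<in> mdom M i"
  using assms unfolding semi_riemannian_def smooth_manifold_def by (metis UN_iff all_not_in_conv)

lemma warped_fibre_einstein:
  assumes "chart_metric M g" "semi_riemannian N g'" "warping_function M \<phi>"
    and "i \<in> midx M" "p \<in> mdom M i"
    and Ric: "\<And>i j p q u v. i \<in> midx M \<Longrightarrow> j \<in> midx N \<Longrightarrow> p \<in> mdom M i \<Longrightarrow> q \<in> mdom N j \<Longrightarrow>
      Ric (M \<times>\<^sub>M\<^sub>f N) (warped_metric g \<phi> g') (i, j) (p, q) u v =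
      \<mu> (p, q) * warped_metric g \<phi> g' (i, j) (p, q) u v"
  shows "einstein_manifold N g'"
proof -
  obtain c where c: "\<And>j q v w. j \<in> midx N \<Longrightarrow> q \<in> mdom N j \<Longrightarrow>
      Ric (M \<times>\<^sub>M\<^sub>f N) (warped_metric g \<phi> g') (i, j) (p, q) (0, v) (0, w) =
      Ric N g' j q v w - c * g' j q v w"
    using Ric_warped_vertical[OF assms(1) semi_riemannian_chart_metric[OF assms(2)] assms(3-5)] by blast
  \<comment> \<open>On vertical vectors the warped metric is the squared warping function times
    \<open>g'\<close>, with \<open>p\<close> fixed; moving the \<open>c\<close> term across gives
    the factor.\<close>
  have "Ric N g' j q v w = (\<mu> (p, q) * (\<phi> p)\<^sup>2 + c) * g' j q v w"
    if "j \<in> midx N" "q \<in> mdom N j" for j q v w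
    using c[OF that, of v w] Ric[OF assms(4) that(1) assms(5) that(2), of "(0, v)" "(0, w)"]
      chart_metric_bilinear[OF assms(1,4,5)]
    by (simp add: warped_metric_def bilinear_lzero algebra_simps)
  then show ?thesis
    by (rule einstein_manifoldI[OF assms(2)])
qed

text \<open>Stated at a single point with real \<open>\<mu>\<close> and \<open>\<psi>\<close>, so
  that it serves both the outer product and the inner one, whose factors are different
  functions.\<close>

lemma warped_base_Ric:
  fixes M :: "('i, 'a, 'e::euclidean_space) mfd" and N :: "('j, 'b, 'f::euclidean_space) mfd"
  assumes "chart_metric M g" "chart_metric N g'" "warping_function M \<phi>"
    and j: "j \<in> midx N" "q \<in> mdom N j" and i: "i \<in> midx M" "p \<in> mdom M i"
    and Ric: "\<And>u v. Ric (M \<times>\<^sub>M\<^sub>f N) (warped_metric g \<phi> g') (i, j) (p, q) u v =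
      \<mu> * warped_metric g \<phi> g' (i, j) (p, q) u v"
    and Hess: "\<And>u v. Hess M g \<phi> i p u v = \<psi> * g i p u v"
  shows "Ric M g i p u v = (\<mu> + DIM('f) / \<phi> p * \<psi>) * g i p u v"
  using Ric_warped_horizontal[OF assms(1-3) i j, of u v] Ric[of "(u, 0)" "(v, 0)"] Hess[of u v]
    chart_metric_bilinear[OF assms(2) j]
  by (simp add: warped_metric_def bilinear_lzero algebra_simps)

theorem theorem3p4:
  fixes M1 :: "('i1, 'a1, 'e1::euclidean_space) mfd"
    and M2 :: "('i2, 'a2, 'e2::euclidean_space) mfd"
    and M3 :: "('i3, 'a3, 'e3::euclidean_space) mfd"
    and g1 :: "('i1, 'a1, 'e1) tensor2"
    and g2 :: "('i2, 'a2, 'e2) tensor2"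
    and g3 :: "('i3, 'a3, 'e3) tensor2"
    and f :: "'a1 \<Rightarrow> real" and h :: "'a1 \<times> 'a2 \<Rightarrow> real"
    and X :: "(('i1 \<times> 'i2) \<times> 'i3, ('a1 \<times> 'a2) \<times> 'a3, ('e1 \<times> 'e2) \<times> 'e3) vfield"
    and lam \<rho> :: real
  assumes "semi_riemannian M1 g1" and "semi_riemannian M2 g2" and "semi_riemannian M3 g3"
    and "warping_function M1 f" and "warping_function (M1 \<times>\<^sub>M\<^sub>f M2) h"
    and "ricci_bourguignon_soliton ((M1 \<times>\<^sub>M\<^sub>f M2) \<times>\<^sub>M\<^sub>f M3) (seq_warped_metric g1 f g2 h g3) X lam \<rho>"
    and "conformal_vfield ((M1 \<times>\<^sub>M\<^sub>f M2) \<times>\<^sub>M\<^sub>f M3) (seq_warped_metric g1 f g2 h g3) X"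
  shows
    "((\<exists>\<sigma>. smooth_fun ((M1 \<times>\<^sub>M\<^sub>f M2) \<times>\<^sub>M\<^sub>f M3) \<sigma> \<and>
          tensor_eq ((M1 \<times>\<^sub>M\<^sub>f M2) \<times>\<^sub>M\<^sub>f M3)
            (Hess ((M1 \<times>\<^sub>M\<^sub>f M2) \<times>\<^sub>M\<^sub>f M3) (seq_warped_metric g1 f g2 h g3) (\<lambda>((p1, p2), p3). f p1))
            (fscale \<sigma> (seq_warped_metric g1 f g2 h g3))) \<and>
      (\<exists>\<psi>. smooth_fun (M1 \<times>\<^sub>M\<^sub>f M2) \<psi> \<and>
          tensor_eq (M1 \<times>\<^sub>M\<^sub>f M2)
            (Hess (M1 \<times>\<^sub>M\<^sub>f M2) (warped_metric g1 f g2) h) (fscale \<psi> (warped_metric g1 f g2)))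
      \<longrightarrow> einstein_manifold M1 g1) \<and>
     ((\<exists>\<psi>. smooth_fun (M1 \<times>\<^sub>M\<^sub>f M2) \<psi> \<and>
          tensor_eq (M1 \<times>\<^sub>M\<^sub>f M2)
            (Hess (M1 \<times>\<^sub>M\<^sub>f M2) (warped_metric g1 f g2) h) (fscale \<psi> (warped_metric g1 f g2)))
      \<longrightarrow> einstein_manifold M2 g2) \<and>
     einstein_manifold M3 g3"
proof -
  let ?B = "M1 \<times>\<^sub>M\<^sub>f M2" and ?gB = "warped_metric g1 f g2"
  let ?M = "?B \<times>\<^sub>M\<^sub>f M3" and ?g = "warped_metric ?gB h g3"
  note c1 = semi_riemannian_chart_metric[OF assms(1)]
    and c2 = semi_riemannian_chart_metric[OF assms(2)]
    and c3 = semi_riemannian_chart_metric[OF assms(3)]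
  note cB = chart_metric_warped[OF c1 c2 assms(4)]
  \<comment> \<open>Manifolds are nonempty, so each factor has a point at which the product
    identities can be restricted.\<close>
  obtain i1 p1 where i1: "i1 \<in> midx M1" "p1 \<in> mdom M1 i1"
    by (rule semi_riemannian_chart_at[OF assms(1)])
  obtain i2 p2 where i2: "i2 \<in> midx M2" "p2 \<in> mdom M2 i2"
    by (rule semi_riemannian_chart_at[OF assms(2)])
  obtain i3 p3 where i3: "i3 \<in> midx M3" "p3 \<in> mdom M3 i3"
    by (rule semi_riemannian_chart_at[OF assms(3)])
  have iB: "(i1, i2) \<in> midx ?B" "(p1, p2) \<in> mdom ?B (i1, i2)"
    using i1 i2 by simp_all
  obtain \<mu> where \<mu>: "\<And>k p u v. k \<in> midx ?M \<Longrightarrow> p \<in> mdom ?M k \<Longrightarrow> Ric ?M ?g k p u v = \<mu> p * ?g k p u v"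
    using conformal_soliton_Ric[OF assms(6,7)] unfolding seq_warped_metric_def by blast
  have third: "einstein_manifold M3 g3"
    by (rule warped_fibre_einstein[OF cB assms(3,5) iB, of \<mu>]) (rule \<mu>; simp)
  \<comment> \<open>Restricting to the slice through \<open>p3\<close> leaves a factor depending on
    \<open>p\<close> alone, so the base satisfies the same kind of equation as the whole
    product.\<close>
  have RicB: "Ric ?B ?gB k p u v = (\<mu> (p, p3) + DIM('e3) / h p * \<psi> p) * ?gB k p u v"
    if "tensor_eq ?B (Hess ?B ?gB h) (fscale \<psi> ?gB)" "k \<in> midx ?B" "p \<in> mdom ?B k" for \<psi> k p u v
  proof (rule warped_base_Ric[OF cB c3 assms(5) i3 that(2,3)])
    show "Ric ?M ?g (k, i3) (p, p3) u v = \<mu> (p, p3) * ?g (k, i3) (p, p3) u v" for u v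
      using that i3 by (intro \<mu>) simp_all
    show "Hess ?B ?gB h k p u v = \<psi> p * ?gB k p u v" for u v
      using that unfolding tensor_eq_def fscale_def by blast
  qed
  \<comment> \<open>The fibre argument again, now for the inner product with fibre \<open>M2\<close>
    and the factor supplied by \<open>RicB\<close>.\<close>
  have second: "einstein_manifold M2 g2" if "tensor_eq ?B (Hess ?B ?gB h) (fscale \<psi> ?gB)" for \<psi>
    by (rule warped_fibre_einstein[OF c1 assms(2,4) i1]) (rule RicB[OF that]; simp)
  have first: "einstein_manifold M1 g1"
    if H: "tensor_eq ?B (Hess ?B ?gB h) (fscale \<psi> ?gB)"
      and F: "tensor_eq ?M (Hess ?M ?g (\<lambda>((p1, p2), p3). f p1)) (fscale \<sigma> ?g)" for \<psi> \<sigma>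
  proof -
    \<comment> \<open>The Hessian condition descends in two stages, through the base of the outer
      product and then to \<open>M1\<close>, at the fixed points \<open>p2\<close> and
      \<open>p3\<close>.\<close>
    have Hess: "Hess M1 g1 f i p u v = \<sigma> ((p, p2), p3) * g1 i p u v"
      if i: "i \<in> midx M1" "p \<in> mdom M1 i" for i p u v
    proof -
      have f: "smooth_fun M1 f" using assms(4) by (simp add: warping_function_def)
      \<comment> \<open>Rewriting the pattern with projections exhibits \<open>f\<close> as a lift
        of a lift, the form that the Hessian comparison expects.\<close>
      have eta: "(\<lambda>((p1, p2), p3). f p1) = (\<lambda>z :: ('a1 \<times> 'a2) \<times> 'a3. f (fst (fst z)))"
        by (simp add: fun_eq_iff)
      have F': "Hess ?M ?g (\<lambda>z. f (fst (fst z))) k p u v = \<sigma> p * ?g k p u v"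
        if "k \<in> midx ?M" "p \<in> mdom ?M k" for k p u v
        using F that unfolding eta tensor_eq_def fscale_def by blast
      have "Hess M1 g1 f i p u v =
          Hess ?B ?gB (\<lambda>z. f (fst z)) (i, i2) (p, p2) (u, 0) (v, 0)"
        by (rule Hess_warped_horizontal[OF c1 c2 assms(4) f i i2, symmetric])
      also have "\<dots> = Hess ?M ?g (\<lambda>z. f (fst (fst z))) ((i, i2), i3) ((p, p2), p3) ((u, 0), 0) ((v, 0), 0)"
        by (rule Hess_warped_horizontal[OF cB c3 assms(5) smooth_fun_compose_fst[OF c1 c2 f], symmetric])
          (use i i2 i3 in simp_all)
      also have "\<dots> = \<sigma> ((p, p2), p3) * ?g ((i, i2), i3) ((p, p2), p3) ((u, 0), 0) ((v, 0), 0)"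
        by (rule F') (use i i2 i3 in simp_all)
      also have "\<dots> = \<sigma> ((p, p2), p3) * g1 i p u v"
        using chart_metric_bilinear[OF c2 i2] chart_metric_bilinear[OF c3 i3]
        by (simp add: warped_metric_def bilinear_lzero)
      finally show ?thesis .
    qed
    show ?thesis
      by (rule einstein_manifoldI[OF assms(1)], rule warped_base_Ric[OF c1 c2 assms(4) i2 _ _ RicB[OF H] Hess])
        (use i2 in simp_all)
  qed
  show ?thesis
    using first second third unfolding seq_warped_metric_def by blast
qed

end
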